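(* Let $W$ be a Gaussian white noise on $\mathbb R\times[0,1]^{\mathbb N}$ with intensity $\mathrm{Leb}_1\otimes P$ ($P$ the law of an i.i.d. uniform$[0,1]$ sequence), $W_l(dx,dy_1,\ldots,dy_l):=W(dx,dy_1,\ldots,dy_l,[0,1]^{\mathbb N})$, $\psi_0(x):=e^{-x}$, $\psi_l(x):=\frac{x^l}{l!}e^{-x}$. Define, for $u\in\mathbb R$, $$Z_1(u):=-\int_{\mathbb R\times[0,1]}\Big(\mathbf 1_{\{y\le \exp(-e^{-(x-u)})\}}-\exp(-e^{-(x-u)})\Big)W_1(dx,dy),$$ $$X_k(u):=\int_{\mathbb R\times[0,1]^{k+1}}\Big(\mathbf 1_{\{y_1\cdots y_{k+1}<\psi_0(e^{-(x-u)})<y_1\cdots y_k\}}-\psi_k(e^{-(x-u)})\Big)W_{k+1}(dx,dy_1,\ldots,dy_{k+1}),\quad k\in\mathbb N,$$ and $Z_l(u):=Z_1(u)-\sum_{k=1}^{l-1}X_k(u)$ for $l\in\mathbb N$. Then each $Z_l=(Z_l(u))_{u\in\mathbb R}$ is a centered stationary Gaussian process with $$\mathrm{Cov}(Z_l(u),Z_l(v))=\log(1+e^{-|u-v|})-\sum_{k=1}^{l-1}\frac{(2k-1)!\,e^{-|u-v|k}}{(k!)^2(1+e^{-|u-v|})^{2k}},\quad u,v\in\mathbb R,$$ and, for $l\in\mathbb N$, $n\in\mathbb N_0$, $u,v\in\mathbb R$, $$\mathbb E Z_l(u)Z_{l+n}(v)=\log(1+e^{-|u-v|})-\sum_{k=1}^{l-1}\frac{(2k-1)!\,e^{-|u-v|k}}{(k!)^2(1+e^{-|u-v|})^{2k}}+\sum_{r=0}^{n-1}\sum_{i=0}^{l-1}\Big(\frac{1}{l+r}\binom{l+r}{i}\big((1-e^{u-v})_+\big)^{l+r-i}e^{(u-v)i}-\frac{1}{l+r+i}\binom{l+r+i}{i}\frac{e^{(u-v)i}}{(1+e^{u-v})^{l+r+i}}\Big).$$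 Moreover, for each $l$, the process $Z_l$ has a version whose sample paths are Hölder continuous with exponent $\alpha$ for each $\alpha\in(0,1/2)$.
   Context: A Gaussian white noise $W$ on a measure space with intensity $\mu$ assigns to each set $A$ of finite $\mu$-measure a centered normal random variable $W(A)$ with $\mathbb E W(A)W(B)=\mu(A\cap B)$; integrals of deterministic square-integrable functions against $W$ are Wiener integrals. $\mathrm{Leb}_1$ is Lebesgue measure on $\mathbb R$. $x_+=\max(x,0)$.
   Formalization: Hölder continuity of the sample paths is stated locally, i.e. on every compact interval; a global Hölder bound on all of ℝ fails almost surely, since the increments of this non-degenerate stationary Gaussian process over unit intervals are unbounded. *)

theory Defs
  imports "HOL-Probability.Probability"
begin

definition centered_normal :: "'w measure \<Rightarrow> ('w \<Rightarrow> real) \<Rightarrow> real \<Rightarrow> bool" where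
  "centered_normal M X s \<longleftrightarrow> X \<in> borel_measurable M \<and>
     ((s = 0 \<and> (AE \<omega> in M. X \<omega> = 0)) \<or>
      (s > 0 \<and> distributed M lborel X (\<lambda>x. ennreal (normal_density 0 (sqrt s) x))))"

definition centered_gaussian_family :: "'w measure \<Rightarrow> 'i set \<Rightarrow> ('i \<Rightarrow> 'w \<Rightarrow> real) \<Rightarrow> bool" where
  "centered_gaussian_family M S X \<longleftrightarrow>
     (\<forall>i\<in>S. X i \<in> borel_measurable M) \<and>
     (\<forall>J c. finite J \<and> J \<subseteq> S \<longrightarrow> (\<exists>s. centered_normal M (\<lambda>\<omega>. \<Sum>i\<in>J. c i * X i \<omega>) s))"

definition stationary_process :: "'w measure \<Rightarrow> (real \<Rightarrow> 'w \<Rightarrow> real) \<Rightarrow> bool" where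
  "stationary_process M Z \<longleftrightarrow>
     (\<forall>J h. finite J \<longrightarrow>
        distr M (PiM J (\<lambda>_. borel)) (\<lambda>\<omega>. \<lambda>i\<in>J. Z (i + h) \<omega>) =
        distr M (PiM J (\<lambda>_. borel)) (\<lambda>\<omega>. \<lambda>i\<in>J. Z i \<omega>))"

definition finite_measure_sets :: "'x measure \<Rightarrow> 'x set set" where
  "finite_measure_sets \<mu> = {A \<in> sets \<mu>. emeasure \<mu> A < \<infinity>}"

definition gaussian_white_noise :: "'w measure \<Rightarrow> 'x measure \<Rightarrow> ('x set \<Rightarrow> 'w \<Rightarrow> real) \<Rightarrow> bool" where
  "gaussian_white_noise M \<mu> W \<longleftrightarrow>
     centered_gaussian_family M (finite_measure_sets \<mu>) W \<and>
     (\<forall>A\<in>finite_measure_sets \<mu>. \<forall>B\<in>finite_measure_sets \<mu>.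
        integral\<^sup>L M (\<lambda>\<omega>. W A \<omega> * W B \<omega>) = measure \<mu> (A \<inter> B))"

definition square_integrable :: "'x measure \<Rightarrow> ('x \<Rightarrow> real) \<Rightarrow> bool" where
  "square_integrable \<mu> f \<longleftrightarrow> f \<in> borel_measurable \<mu> \<and> integrable \<mu> (\<lambda>x. (f x)^2)"

text \<open>I is the Wiener integral w.r.t. W: linear (a.s.), extends W on indicators (a.s.),
  and isometric from L2(\<mu>) to L2(M).  These properties determine I f a.s.\<close>
definition wiener_integral :: "'w measure \<Rightarrow> 'x measure \<Rightarrow> ('x set \<Rightarrow> 'w \<Rightarrow> real)
    \<Rightarrow> (('x \<Rightarrow> real) \<Rightarrow> 'w \<Rightarrow> real) \<Rightarrow> bool" where
  "wiener_integral M \<mu> W I \<longleftrightarrow>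
     (\<forall>A\<in>finite_measure_sets \<mu>. AE \<omega> in M. I (indicator A) \<omega> = W A \<omega>) \<and>
     (\<forall>f g a b. square_integrable \<mu> f \<longrightarrow> square_integrable \<mu> g \<longrightarrow>
        (AE \<omega> in M. I (\<lambda>x. a * f x + b * g x) \<omega> = a * I f \<omega> + b * I g \<omega>)) \<and>
     (\<forall>f. square_integrable \<mu> f \<longrightarrow>
        I f \<in> borel_measurable M \<and> integrable M (\<lambda>\<omega>. (I f \<omega>)^2) \<and>
        integral\<^sup>L M (\<lambda>\<omega>. (I f \<omega>)^2) = integral\<^sup>L \<mu> (\<lambda>x. (f x)^2))"

text \<open>P: law of an i.i.d. uniform[0,1] sequence (coordinates y 0, y 1, ... = y_1, y_2, ...).\<close>
definition P_unif :: "(nat \<Rightarrow> real) measure" where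
  "P_unif = PiM UNIV (\<lambda>_. uniform_measure lborel {0..1})"

definition intensity :: "(real \<times> (nat \<Rightarrow> real)) measure" where
  "intensity = lborel \<Otimes>\<^sub>M P_unif"

definition psi :: "nat \<Rightarrow> real \<Rightarrow> real" where
  "psi l x = x ^ l / fact l * exp (- x)"

text \<open>Integrals against W_l are integrals against W of functions depending only on
  (x, y_1, ..., y_l), i.e. on x and the coordinates y 0, ..., y (l-1).\<close>
definition Z1 :: "(((real \<times> (nat \<Rightarrow> real)) \<Rightarrow> real) \<Rightarrow> 'w \<Rightarrow> real) \<Rightarrow> real \<Rightarrow> 'w \<Rightarrow> real" where
  "Z1 I u = (\<lambda>\<omega>. - I (\<lambda>(x, y). (if y 0 \<le> exp (- exp (- (x - u))) then 1 else 0)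
                               - exp (- exp (- (x - u)))) \<omega>)"

definition Xk :: "(((real \<times> (nat \<Rightarrow> real)) \<Rightarrow> real) \<Rightarrow> 'w \<Rightarrow> real) \<Rightarrow> nat \<Rightarrow> real \<Rightarrow> 'w \<Rightarrow> real" where
  "Xk I k u = I (\<lambda>(x, y).
      (if (\<Prod>i<k+1. y i) < psi 0 (exp (- (x - u))) \<and> psi 0 (exp (- (x - u))) < (\<Prod>i<k. y i)
       then 1 else 0) - psi k (exp (- (x - u))))"

definition Zl :: "(((real \<times> (nat \<Rightarrow> real)) \<Rightarrow> real) \<Rightarrow> 'w \<Rightarrow> real) \<Rightarrow> nat \<Rightarrow> real \<Rightarrow> 'w \<Rightarrow> real" where
  "Zl I l u = (\<lambda>\<omega>. Z1 I u \<omega> - (\<Sum>k\<in>{1..<l}. Xk I k u \<omega>))"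

definition cov_Z :: "nat \<Rightarrow> real \<Rightarrow> real" where
  "cov_Z l t = ln (1 + exp (- \<bar>t\<bar>))
     - (\<Sum>k\<in>{1..<l}. fact (2*k - 1) * exp (- \<bar>t\<bar> * k) / ((fact k)^2 * (1 + exp (- \<bar>t\<bar>)) ^ (2*k)))"

definition cross_cov_Z :: "nat \<Rightarrow> nat \<Rightarrow> real \<Rightarrow> real \<Rightarrow> real" where
  "cross_cov_Z l n u v = cov_Z l (u - v) +
     (\<Sum>r<n. \<Sum>i<l.
        1 / real (l + r) * real ((l + r) choose i) * (max 0 (1 - exp (u - v))) ^ (l + r - i) * exp ((u - v) * i)
      - 1 / real (l + r + i) * real ((l + r + i) choose i) * exp ((u - v) * i) / (1 + exp (u - v)) ^ (l + r + i))"

definition locally_holder :: "(real \<Rightarrow> real) \<Rightarrow> real \<Rightarrow> bool" where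
  "locally_holder f \<alpha> \<longleftrightarrow>
     (\<forall>a b. \<exists>C. \<forall>u\<in>{a..b}. \<forall>v\<in>{a..b}. \<bar>f u - f v\<bar> \<le> C * \<bar>u - v\<bar> powr \<alpha>)"

end

theory Submission
  imports Defs
begin

text \<open>
  Put \<open>s = exp (u - x)\<close> and let \<open>N\<close> be the Poisson process whose arrival times are
  \<open>- ln (y\<^sub>1 \<cdots> y\<^sub>k)\<close>.  The integrand of \<open>X\<^sub>k(u)\<close> is the centered indicator of the event
  \<open>N(s) = k\<close>, and \<open>Z\<^sub>1 = - X\<^sub>0\<close> almost surely, so that
  \<open>Z\<^sub>l = - (X\<^sub>0 + \<cdots> + X\<^sub>l\<^sub>-\<^sub>1)\<close>.  By the Wiener isometry the covariance of \<open>X\<^sub>i(u)\<close> and \<open>X\<^sub>j(v)\<close>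
  is the integral over \<open>x\<close> of a covariance of Poisson events, which reduces to Gamma integrals
  (a Frullani integral for \<open>i = j = 0\<close>).  Summing over \<open>i, j < l\<close> telescopes in \<open>l\<close> because of the
  identity for the two ways in which a sequence of Bernoulli trials can be decided.
  Gaussian laws are determined by their covariances, which gives stationarity, and the increments
  satisfy \<open>E (Z\<^sub>l(u) - Z\<^sub>l(v))\<^sup>2 = O(\<bar>u - v\<bar>)\<close>, so all their even moments are controlled and the
  Kolmogorov-Chentsov argument yields the Hoelder continuous version.
\<close>

section \<open>Wiener integrals are Gaussian\<close>

text \<open>The hypotheses on \<open>I\<close> give only almost sure linearity, agreement with
  \<open>W\<close> on sets and isometry, so Gaussianity of the integrals has to be earned: simple
  functions inherit it from the noise, and L2 limits keep it because characteristic functions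
  converge. Covariances are computed for u \<le> v, where the joint Poisson probability is explicit;
  symmetry gives the other order. The pair i = j = 0 stands apart: the joint probability and the
  product of the marginals both tend to 1 as x grows, so only their difference is integrable.
  Otherwise each part is zero or keeps a factor \<open>exp (- x)\<close> and is a Gamma integral.
  The telescoping works because enlarging l by one adds one row and one column of covariances: the
  joint probabilities sum by the binomial theorem, the products by the trial identity with equal
  thresholds, and all that survives is the central binomial term of the diagonal.\<close>

lemma square_integrable_mult:
  assumes "square_integrable \<mu> f" "square_integrable \<mu> g"
  shows "integrable \<mu> (\<lambda>x. f x * g x)"
proof (rule Bochner_Integration.integrable_bound)
  show "integrable \<mu> (\<lambda>x. (f x)\<^sup>2 + (g x)\<^sup>2)"
    using assms by (auto simp: square_integrable_def)
  show "(\<lambda>x. f x * g x) \<in> borel_measurable \<mu>"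
    using assms by (auto simp: square_integrable_def)
  have "\<bar>a * b\<bar> \<le> a\<^sup>2 + b\<^sup>2" for a b :: real
  proof -
    have "0 \<le> \<bar>a\<bar> * \<bar>b\<bar>" by simp
    then show ?thesis
      using sum_squares_bound[of "\<bar>a\<bar>" "\<bar>b\<bar>"] unfolding abs_mult power2_abs by linarith
  qed
  then show "AE x in \<mu>. norm (f x * g x) \<le> norm ((f x)\<^sup>2 + (g x)\<^sup>2)"
    by auto
qed

lemma square_integrable_lincomb:
  assumes "square_integrable \<mu> f" "square_integrable \<mu> g"
  shows "square_integrable \<mu> (\<lambda>x. a * f x + b * g x)"
proof -
  have "integrable \<mu> (\<lambda>x. a\<^sup>2 * (f x)\<^sup>2 + b\<^sup>2 * (g x)\<^sup>2 + 2 * a * b * (f x * g x))"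
    using assms square_integrable_mult[OF assms] by (auto simp: square_integrable_def)
  then show ?thesis using assms
    by (auto simp: square_integrable_def power2_eq_square algebra_simps)
qed

lemma square_integrable_zero [simp]: "square_integrable \<mu> (\<lambda>x. 0)"
  by (simp add: square_integrable_def)

lemma square_integrable_sum:
  assumes "\<And>i. i \<in> J \<Longrightarrow> square_integrable \<mu> (f i)"
  shows "square_integrable \<mu> (\<lambda>x. \<Sum>i\<in>J. c i * f i x)"
  using assms
proof (induction J rule: infinite_finite_induct)
  case (insert i J)
  then show ?case
    using square_integrable_lincomb[of \<mu> "f i" "\<lambda>x. \<Sum>i\<in>J. c i * f i x" "c i" 1] by simp
qed auto

section \<open>Centered normal laws and their characteristic functions\<close>

lemma AE_eq_0_if_second_moment_0:
  fixes X :: "'w \<Rightarrow> real"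
  assumes "integrable M (\<lambda>\<omega>. (X \<omega>)\<^sup>2)" "(\<integral>\<omega>. (X \<omega>)\<^sup>2 \<partial>M) = 0"
  shows "AE \<omega> in M. X \<omega> = 0"
  using integral_nonneg_eq_0_iff_AE[OF assms(1)] assms(2) by simp

lemma (in prob_space) char_distr_eq:
  assumes [measurable]: "random_variable borel X"
  shows "char (distr M borel X) t = (CLINT \<omega>|M. iexp (t * X \<omega>))"
  unfolding char_def by (subst integral_distr) auto

text \<open>The point mass at 0 obeys the same formula with s = 0, so later arguments need no case
  distinction on the variance. For s > 0, dividing by \<open>sqrt s\<close> reduces to the standard
  normal law.\<close>

lemma (in prob_space) char_centered_normal:
  assumes "centered_normal M X s"
  shows "char (distr M borel X) t = complex_of_real (exp (- (s * t\<^sup>2) / 2))"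
proof -
  have [measurable]: "random_variable borel X"
    using assms by (simp add: centered_normal_def)
  consider "s = 0" "AE \<omega> in M. X \<omega> = 0"
    | "s > 0" "distributed M lborel X (\<lambda>x. ennreal (normal_density 0 (sqrt s) x))"
    using assms by (auto simp: centered_normal_def)
  then show ?thesis
  proof cases
    case 1
    have "(CLINT \<omega>|M. iexp (t * X \<omega>)) = (CLINT \<omega>|M. 1)"
      using 1(2) by (intro integral_cong_AE) auto
    then show ?thesis using 1(1) by (simp add: char_distr_eq prob_space)
  next
    case 2
    let ?Y = "\<lambda>\<omega>. X \<omega> / sqrt s"
    have "distributed M lborel (\<lambda>\<omega>. 0 + (1 / sqrt s) * X \<omega>)
        (normal_density (0 + (1 / sqrt s) * 0) (\<bar>1 / sqrt s\<bar> * sqrt s))"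
      using 2 by (intro normal_density_affine) auto
    then have "distributed M lborel ?Y std_normal_density"
      using 2(1) by simp
    then have Y: "distr M borel ?Y = std_normal_distribution"
      by (simp add: distributed_def cong: distr_cong)
    have "char (distr M borel X) t = char (distr M borel ?Y) (t * sqrt s)"
      using 2(1) by (simp add: char_distr_eq)
    also have "\<dots> = complex_of_real (exp (- (s * t\<^sup>2) / 2))"
      using 2(1) by (simp add: Y char_std_normal_distribution power_mult_distrib mult.commute)
    finally show ?thesis .
  qed
qed

lemma (in prob_space) centered_normalI_char:
  assumes [measurable]: "random_variable borel X" and "0 \<le> s"
    and char: "\<And>t. char (distr M borel X) t = complex_of_real (exp (- (s * t\<^sup>2) / 2))"
  shows "centered_normal M X s"
proof (cases "s = 0")
  case True
  interpret X: real_distribution "distr M borel X" by (rule real_distribution_distr) fact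
  interpret Z: real_distribution "distr M borel (\<lambda>_. 0::real)" by (rule real_distribution_distr) simp
  have "distr M borel X = distr M borel (\<lambda>_. 0::real)"
  proof (rule Levy_uniqueness)
    show "char (distr M borel X) = char (distr M borel (\<lambda>_. 0::real))"
    proof
      show "char (distr M borel X) t = char (distr M borel (\<lambda>_. 0::real)) t" for t
        using char[of t] True by (subst (2) char_distr_eq) (auto simp: prob_space)
    qed
  qed unfold_locales
  moreover have "AE x in distr M borel (\<lambda>_. 0::real). x = 0"
    by (subst AE_distr_iff) auto
  ultimately have "AE x in distr M borel X. x = 0"
    by (simp only:)
  then have "AE \<omega> in M. X \<omega> = 0"
    by (subst (asm) AE_distr_iff) auto
  then show ?thesis using True by (simp add: centered_normal_def)
next
  case False
  with \<open>0 \<le> s\<close> have s: "0 < s" by simp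
  let ?N = "density lborel (\<lambda>x. ennreal (normal_density 0 (sqrt s) x))"
  interpret N: prob_space ?N by (rule prob_space_normal_density) (use s in simp)
  interpret N: real_distribution ?N by unfold_locales auto
  interpret X: real_distribution "distr M borel X" by (rule real_distribution_distr) fact
  have "distr M borel X = ?N"
  proof (rule Levy_uniqueness)
    have "centered_normal ?N (\<lambda>x. x) s"
      using s by (auto simp: centered_normal_def distributed_def distr_id2)
    from N.char_centered_normal[OF this]
    have "char ?N t = complex_of_real (exp (- (s * t\<^sup>2) / 2))" for t
      by (simp add: distr_id2)
    then show "char (distr M borel X) = char ?N"
      using char by (simp add: fun_eq_iff)
  qed unfold_locales
  then show ?thesis using s
    by (auto simp: centered_normal_def distributed_def cong: distr_cong)
qed

text \<open>The constant is the double factorial (2k - 1)!!. The case k = 1 identifies s as the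
  second moment; large k feeds the Kolmogorov-Chentsov argument.\<close>

lemma centered_normal_even_moment:
  assumes "centered_normal M X s" "1 \<le> k"
  shows "integrable M (\<lambda>\<omega>. X \<omega> ^ (2 * k))"
    and "(\<integral>\<omega>. X \<omega> ^ (2 * k) \<partial>M) = fact (2 * k) / (2 ^ k * fact k) * s ^ k"
proof -
  have [measurable]: "X \<in> borel_measurable M"
    using assms by (simp add: centered_normal_def)
  consider "s = 0" "AE \<omega> in M. X \<omega> = 0"
    | "s > 0" "distributed M lborel X (\<lambda>x. ennreal (normal_density 0 (sqrt s) x))"
    using assms by (auto simp: centered_normal_def)
  then have "has_bochner_integral M (\<lambda>\<omega>. X \<omega> ^ (2 * k)) (fact (2 * k) / (2 ^ k * fact k) * s ^ k)"
  proof cases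
    case 1
    have "has_bochner_integral M (\<lambda>\<omega>. X \<omega> ^ (2 * k)) 0 \<longleftrightarrow> has_bochner_integral M (\<lambda>\<omega>. 0::real) 0"
      using 1(2) assms(2) by (intro has_bochner_integral_cong_AE) auto
    then show ?thesis using 1(1) assms(2) by (simp add: has_bochner_integral_zero power_0_left)
  next
    case 2
    have "has_bochner_integral lborel (\<lambda>x. normal_density 0 (sqrt s) x * x ^ (2 * k))
        (fact (2 * k) / ((2 / (sqrt s)\<^sup>2) ^ k * fact k))"
      using normal_moment_even[of "sqrt s" 0 k] 2(1) by simp
    then show ?thesis
      using distributed_integrable[OF 2(2), of "\<lambda>x. x ^ (2 * k)"]
        distributed_integral[OF 2(2), of "\<lambda>x. x ^ (2 * k)"] 2(1)
      by (simp add: has_bochner_integral_iff power_divide)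
  qed
  then show "integrable M (\<lambda>\<omega>. X \<omega> ^ (2 * k))"
    and "(\<integral>\<omega>. X \<omega> ^ (2 * k) \<partial>M) = fact (2 * k) / (2 ^ k * fact k) * s ^ k"
    by (simp_all add: has_bochner_integral_iff)
qed

lemma centered_normal_cong_AE:
  assumes "centered_normal M X s" "AE \<omega> in M. X \<omega> = Y \<omega>" and [measurable]: "Y \<in> borel_measurable M"
  shows "centered_normal M Y s"
proof -
  have [measurable]: "X \<in> borel_measurable M" using assms by (simp add: centered_normal_def)
  have "distr M lborel X = distr M lborel Y"
    using assms(2) by (intro distr_cong_AE) auto
  moreover have "AE \<omega> in M. Y \<omega> = 0" if "AE \<omega> in M. X \<omega> = 0"
    using that assms(2) by eventually_elim simp
  ultimately show ?thesis
    using assms(1) unfolding centered_normal_def distributed_def by (metis assms(3) measurable_lborel1)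
qed


text \<open>The inequality is the nonnegativity of the variance of the absolute value of D.\<close>

lemma (in prob_space) square_expectation_abs_le:
  fixes D :: "'a \<Rightarrow> real"
  assumes [measurable]: "random_variable borel D" and "integrable M (\<lambda>\<omega>. (D \<omega>)\<^sup>2)"
  shows "integrable M D" "(expectation (\<lambda>\<omega>. \<bar>D \<omega>\<bar>))\<^sup>2 \<le> expectation (\<lambda>\<omega>. (D \<omega>)\<^sup>2)"
proof -
  show D: "integrable M D" using assms by (rule square_integrable_imp_integrable)
  show "(expectation (\<lambda>\<omega>. \<bar>D \<omega>\<bar>))\<^sup>2 \<le> expectation (\<lambda>\<omega>. (D \<omega>)\<^sup>2)"
    using variance_eq[of "\<lambda>\<omega>. \<bar>D \<omega>\<bar>"] variance_positive[of "\<lambda>\<omega>. \<bar>D \<omega>\<bar>"] D assms(2) by simp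
qed

lemma cmod_iexp_diff_le: "cmod (iexp a - iexp b) \<le> \<bar>a - b\<bar>"
proof -
  have "iexp a - iexp b = iexp b * (iexp (a - b) - 1)"
    by (simp add: algebra_simps flip: exp_add)
  then have "cmod (iexp a - iexp b) = cmod (iexp (a - b) - 1)"
    by (simp add: norm_mult)
  also have "\<dots> \<le> \<bar>a - b\<bar>" using iexp_approx1[of "a - b" 0] by simp
  finally show ?thesis .
qed

text \<open>Since \<open>iexp\<close> is 1-Lipschitz, L2 convergence forces pointwise convergence of
  characteristic functions. This is how Gaussianity passes to limits of Wiener integrals.\<close>

lemma (in prob_space) char_diff_le:
  fixes X Y :: "'a \<Rightarrow> real"
  assumes [measurable]: "random_variable borel X" "random_variable borel Y"
    and int: "integrable M (\<lambda>\<omega>. (X \<omega> - Y \<omega>)\<^sup>2)"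
  shows "cmod (char (distr M borel X) t - char (distr M borel Y) t)
    \<le> \<bar>t\<bar> * sqrt (expectation (\<lambda>\<omega>. (X \<omega> - Y \<omega>)\<^sup>2))"
proof -
  have D: "integrable M (\<lambda>\<omega>. X \<omega> - Y \<omega>)"
    "(expectation (\<lambda>\<omega>. \<bar>X \<omega> - Y \<omega>\<bar>))\<^sup>2 \<le> expectation (\<lambda>\<omega>. (X \<omega> - Y \<omega>)\<^sup>2)"
    using square_expectation_abs_le[of "\<lambda>\<omega>. X \<omega> - Y \<omega>"] int by auto
  have "char (distr M borel X) t - char (distr M borel Y) t =
      (CLINT \<omega>|M. iexp (t * X \<omega>) - iexp (t * Y \<omega>))"
    by (simp only: char_distr_eq assms, rule Bochner_Integration.integral_diff[symmetric];
        rule integrable_iexp; simp)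
  also have "cmod \<dots> \<le> (\<integral>\<omega>. cmod (iexp (t * X \<omega>) - iexp (t * Y \<omega>)) \<partial>M)"
    by (rule integral_norm_bound)
  also have "\<dots> \<le> (\<integral>\<omega>. \<bar>t\<bar> * \<bar>X \<omega> - Y \<omega>\<bar> \<partial>M)"
  proof (rule integral_mono)
    show "integrable M (\<lambda>\<omega>. cmod (iexp (t * X \<omega>) - iexp (t * Y \<omega>)))"
      by (intro integrable_norm Bochner_Integration.integrable_diff; rule integrable_iexp; simp)
    show "cmod (iexp (t * X \<omega>) - iexp (t * Y \<omega>)) \<le> \<bar>t\<bar> * \<bar>X \<omega> - Y \<omega>\<bar>" for \<omega>
      using cmod_iexp_diff_le[of "t * X \<omega>" "t * Y \<omega>"] by (simp add: abs_mult flip: right_diff_distrib)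
  qed (use D in auto)
  also have "\<dots> = \<bar>t\<bar> * expectation (\<lambda>\<omega>. \<bar>X \<omega> - Y \<omega>\<bar>)" by simp
  also have "\<dots> \<le> \<bar>t\<bar> * sqrt (expectation (\<lambda>\<omega>. (X \<omega> - Y \<omega>)\<^sup>2))"
    using D(2) by (intro mult_left_mono real_le_rsqrt) auto
  finally show ?thesis .
qed

section \<open>The Wiener integral as a Gaussian isometry\<close>

locale wiener = prob_space M for M :: "'w measure" +
  fixes \<mu> :: "'x measure" and W :: "'x set \<Rightarrow> 'w \<Rightarrow> real" and I :: "('x \<Rightarrow> real) \<Rightarrow> 'w \<Rightarrow> real"
  assumes white_noise: "gaussian_white_noise M \<mu> W"
    and integral: "wiener_integral M \<mu> W I"
begin

lemma I_measurable [measurable]: "square_integrable \<mu> f \<Longrightarrow> I f \<in> borel_measurable M"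
  and I_square_integrable: "square_integrable \<mu> f \<Longrightarrow> integrable M (\<lambda>\<omega>. (I f \<omega>)\<^sup>2)"
  and I_isometry: "square_integrable \<mu> f \<Longrightarrow> (\<integral>\<omega>. (I f \<omega>)\<^sup>2 \<partial>M) = (\<integral>x. (f x)\<^sup>2 \<partial>\<mu>)"
  and I_indicator: "A \<in> finite_measure_sets \<mu> \<Longrightarrow> AE \<omega> in M. I (indicator A) \<omega> = W A \<omega>"
  and I_lincomb: "square_integrable \<mu> f \<Longrightarrow> square_integrable \<mu> g \<Longrightarrow>
    AE \<omega> in M. I (\<lambda>x. a * f x + b * g x) \<omega> = a * I f \<omega> + b * I g \<omega>"
  using integral by (simp_all add: wiener_integral_def)

lemma I_zero: "AE \<omega> in M. I (\<lambda>x. 0) \<omega> = 0"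
  using I_square_integrable I_isometry by (intro AE_eq_0_if_second_moment_0) simp_all

lemma I_diff_second_moment:
  assumes "square_integrable \<mu> f" "square_integrable \<mu> g"
  shows "integrable M (\<lambda>\<omega>. (I f \<omega> - I g \<omega>)\<^sup>2)"
    and "(\<integral>\<omega>. (I f \<omega> - I g \<omega>)\<^sup>2 \<partial>M) = (\<integral>x. (f x - g x)\<^sup>2 \<partial>\<mu>)"
proof -
  have sq: "square_integrable \<mu> (\<lambda>x. f x - g x)"
    using square_integrable_lincomb[OF assms, of 1 "-1"] by simp
  have "AE \<omega> in M. I (\<lambda>x. f x - g x) \<omega> = I f \<omega> - I g \<omega>"
    using I_lincomb[OF assms, of 1 "-1"] by simp
  then have ae: "AE \<omega> in M. (I (\<lambda>x. f x - g x) \<omega>)\<^sup>2 = (I f \<omega> - I g \<omega>)\<^sup>2"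
    by eventually_elim simp
  note [measurable] = I_measurable[OF assms(1)] I_measurable[OF assms(2)] I_measurable[OF sq]
  show "integrable M (\<lambda>\<omega>. (I f \<omega> - I g \<omega>)\<^sup>2)"
    using I_square_integrable[OF sq] by (rule integrable_cong_AE[THEN iffD1, rotated 3]) (use ae in auto)
  have "(\<integral>\<omega>. (I f \<omega> - I g \<omega>)\<^sup>2 \<partial>M) = (\<integral>\<omega>. (I (\<lambda>x. f x - g x) \<omega>)\<^sup>2 \<partial>M)"
    by (rule integral_cong_AE) (use ae in auto)
  then show "(\<integral>\<omega>. (I f \<omega> - I g \<omega>)\<^sup>2 \<partial>M) = (\<integral>x. (f x - g x)\<^sup>2 \<partial>\<mu>)"
    using I_isometry[OF sq] by simp
qed

text \<open>\<open>I\<close> acts on functions, not on classes modulo null sets; the isometry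
  applied to the difference makes it well defined on classes.\<close>

lemma I_cong_AE:
  assumes "square_integrable \<mu> f" "square_integrable \<mu> g" "AE x in \<mu>. f x = g x"
  shows "AE \<omega> in M. I f \<omega> = I g \<omega>"
proof -
  have [measurable]: "f \<in> borel_measurable \<mu>" "g \<in> borel_measurable \<mu>"
    using assms by (auto simp: square_integrable_def)
  have "(\<integral>x. (f x - g x)\<^sup>2 \<partial>\<mu>) = (\<integral>x. 0 \<partial>\<mu>)"
    using assms(3) by (intro integral_cong_AE) auto
  then have "AE \<omega> in M. I f \<omega> - I g \<omega> = 0"
    using I_diff_second_moment[OF assms(1,2)] by (intro AE_eq_0_if_second_moment_0) auto
  then show ?thesis by eventually_elim simp
qed

lemma I_sum:
  assumes "finite J" "\<And>i. i \<in> J \<Longrightarrow> square_integrable \<mu> (f i)"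
  shows "AE \<omega> in M. I (\<lambda>x. \<Sum>i\<in>J. c i * f i x) \<omega> = (\<Sum>i\<in>J. c i * I (f i) \<omega>)"
  using assms
proof (induction J rule: finite_induct)
  case empty
  then show ?case using I_zero by simp
next
  case (insert i J)
  have "AE \<omega> in M. I (\<lambda>x. c i * f i x + 1 * (\<Sum>i\<in>J. c i * f i x)) \<omega> =
      c i * I (f i) \<omega> + 1 * I (\<lambda>x. \<Sum>i\<in>J. c i * f i x) \<omega>"
    using insert by (intro I_lincomb square_integrable_sum) auto
  moreover have "AE \<omega> in M. I (\<lambda>x. \<Sum>i\<in>J. c i * f i x) \<omega> = (\<Sum>i\<in>J. c i * I (f i) \<omega>)"
    using insert by auto
  ultimately show ?case
  proof eventually_elim
    case (elim \<omega>)
    then show ?case using insert by simp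
  qed
qed

text \<open>Polarization: the isometry speaks of squares only, and inner products are recovered from
  the squares of f, g and f - g.\<close>

lemma I_product:
  assumes "square_integrable \<mu> f" "square_integrable \<mu> g"
  shows "(\<integral>\<omega>. I f \<omega> * I g \<omega> \<partial>M) = (\<integral>x. f x * g x \<partial>\<mu>)"
proof -
  have polar: "a * b = (a\<^sup>2 + b\<^sup>2 - (a - b)\<^sup>2) / 2" for a b :: real
    by (simp add: power2_eq_square algebra_simps)
  have fg: "integrable \<mu> (\<lambda>x. (f x)\<^sup>2)" "integrable \<mu> (\<lambda>x. (g x)\<^sup>2)" "integrable \<mu> (\<lambda>x. (f x - g x)\<^sup>2)"
    using assms square_integrable_lincomb[OF assms, of 1 "-1"] by (auto simp: square_integrable_def)
  show ?thesis
    unfolding polar using assms I_diff_second_moment[OF assms] fg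
    by (simp add: I_square_integrable I_isometry)
qed

lemma I_simple_centered_normal:
  assumes F: "simple_function \<mu> F" "square_integrable \<mu> F"
  shows "centered_normal M (I F) (\<integral>x. (F x)\<^sup>2 \<partial>\<mu>)"
proof -
  \<comment> \<open>The value 0 is left out because its level set may have infinite measure; every
    other level set has finite measure by square integrability, as the bound by F squared over y
    squared shows.\<close>
  define Y where "Y = F ` space \<mu> - {0}"
  define A where "A y = F -` {y} \<inter> space \<mu>" for y
  have "finite Y" using F by (simp add: Y_def simple_function_def)
  have A: "A y \<in> sets \<mu>" for y
    using F(1) by (simp add: A_def simple_functionD)
  have fin: "A y \<in> finite_measure_sets \<mu>" if "y \<in> Y" for y
  proof -
    have "integrable \<mu> (\<lambda>x. (1 / y\<^sup>2) * (F x)\<^sup>2)"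
      using F(2) by (simp add: square_integrable_def)
    then have "integrable \<mu> (indicator (A y) :: _ \<Rightarrow> real)"
      using A that by (rule_tac Bochner_Integration.integrable_bound)
        (auto simp: A_def Y_def indicator_def)
    then show ?thesis using A[of y] sets.sets_into_space[OF A[of y]]
      by (auto simp: finite_measure_sets_def integrable_indicator_iff Int_absorb2)
  qed
  have ind: "square_integrable \<mu> (indicator (A y))" if "y \<in> Y" for y
    using fin[OF that]
    by (auto simp: square_integrable_def finite_measure_sets_def power2_eq_square
        integrable_indicator_iff indicator_inter_arith[symmetric] intro!: integrable_real_indicator)
  have F_eq: "F x = (\<Sum>y\<in>Y. y * indicator (A y) x)" if "x \<in> space \<mu>" for x
  proof -
    have "(\<Sum>y\<in>Y. y * indicator (A y) x) = (\<Sum>y\<in>Y. if y = F x then F x else 0)"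
      using that by (intro sum.cong) (auto simp: A_def indicator_def)
    then show ?thesis using \<open>finite Y\<close> that by (simp add: Y_def)
  qed
  have "AE \<omega> in M. I F \<omega> = I (\<lambda>x. \<Sum>y\<in>Y. y * indicator (A y) x) \<omega>"
    using F_eq by (intro I_cong_AE F square_integrable_sum ind) auto
  moreover have "AE \<omega> in M. I (\<lambda>x. \<Sum>y\<in>Y. y * indicator (A y) x) \<omega> = (\<Sum>y\<in>Y. y * I (indicator (A y)) \<omega>)"
    using \<open>finite Y\<close> by (intro I_sum ind)
  moreover have "AE \<omega> in M. \<forall>y\<in>Y. I (indicator (A y)) \<omega> = W (A y) \<omega>"
    using \<open>finite Y\<close> fin by (intro AE_finite_allI I_indicator) auto
  ultimately have IF: "AE \<omega> in M. (\<Sum>y\<in>Y. y * W (A y) \<omega>) = I F \<omega>"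
    by eventually_elim auto
  \<comment> \<open>The noise is a family indexed by sets, so the coefficient y must become a
    function of its level set. Level sets of attained values are nonempty and disjoint, hence
    distinct.\<close>
  have inj: "inj_on A Y"
    by (auto simp: inj_on_def A_def Y_def)
  have "\<exists>s. centered_normal M (\<lambda>\<omega>. \<Sum>B\<in>A ` Y. inv_into Y A B * W B \<omega>) s"
  proof -
    have "finite (A ` Y)" "A ` Y \<subseteq> finite_measure_sets \<mu>"
      using fin \<open>finite Y\<close> by auto
    then show ?thesis
      using white_noise unfolding gaussian_white_noise_def centered_gaussian_family_def by blast
  qed
  moreover have "(\<lambda>\<omega>. \<Sum>B\<in>A ` Y. inv_into Y A B * W B \<omega>) = (\<lambda>\<omega>. \<Sum>y\<in>Y. y * W (A y) \<omega>)"
    using inj by (simp add: sum.reindex)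
  ultimately obtain s where "centered_normal M (\<lambda>\<omega>. \<Sum>y\<in>Y. y * W (A y) \<omega>) s"
    by auto
  then have n: "centered_normal M (I F) s"
    using IF I_measurable[OF F(2)] by (rule centered_normal_cong_AE)
  \<comment> \<open>The white noise only yields some variance s; the second moment and the isometry
    identify it.\<close>
  have "(\<integral>x. (F x)\<^sup>2 \<partial>\<mu>) = s"
    using centered_normal_even_moment(2)[OF n, of 1] I_isometry[OF F(2)] by simp
  with n show ?thesis by simp
qed

text \<open>Simple functions dominated by twice the absolute value of f converge to f in L2, so by
  isometry their integrals converge in L2. The characteristic functions then converge both to that
  of \<open>I f\<close> and to the Gaussian one with the limiting variance.\<close>

lemma I_centered_normal:
  assumes f: "square_integrable \<mu> f"
  shows "centered_normal M (I f) (\<integral>x. (f x)\<^sup>2 \<partial>\<mu>)"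
proof -
  have [measurable]: "f \<in> borel_measurable \<mu>" and f2: "integrable \<mu> (\<lambda>x. (f x)\<^sup>2)"
    using f by (auto simp: square_integrable_def)
  obtain F where F: "\<And>n. simple_function \<mu> (F n)" "\<And>x. x \<in> space \<mu> \<Longrightarrow> (\<lambda>n. F n x) \<longlonglongrightarrow> f x"
    "\<And>n x. x \<in> space \<mu> \<Longrightarrow> \<bar>F n x\<bar> \<le> 2 * \<bar>f x\<bar>"
    using borel_measurable_implies_sequence_metric[of f \<mu> 0] by (simp add: dist_real_def) metis
  have [measurable]: "F n \<in> borel_measurable \<mu>" for n
    using F(1) by (rule borel_measurable_simple_function)
  have le: "(F n x)\<^sup>2 \<le> 4 * (f x)\<^sup>2" "(F n x - f x)\<^sup>2 \<le> 9 * (f x)\<^sup>2" if "x \<in> space \<mu>" for n x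
  proof -
    have "\<bar>F n x\<bar> \<le> \<bar>2 * f x\<bar>" "\<bar>F n x - f x\<bar> \<le> \<bar>3 * f x\<bar>"
      using F(3)[OF that, of n] by linarith+
    from this[THEN abs_le_square_iff[THEN iffD1]] show "(F n x)\<^sup>2 \<le> 4 * (f x)\<^sup>2" "(F n x - f x)\<^sup>2 \<le> 9 * (f x)\<^sup>2"
      by (simp_all add: power_mult_distrib)
  qed
  have Fsq: "square_integrable \<mu> (F n)" for n
    unfolding square_integrable_def
  proof
    show "integrable \<mu> (\<lambda>x. (F n x)\<^sup>2)"
      by (rule Bochner_Integration.integrable_bound[of \<mu> "\<lambda>x. 4 * (f x)\<^sup>2"]) (use f2 le(1) in auto)
  qed simp
  have lim1: "(\<lambda>n. \<integral>x. (F n x)\<^sup>2 \<partial>\<mu>) \<longlonglongrightarrow> (\<integral>x. (f x)\<^sup>2 \<partial>\<mu>)"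
    using f2 le(1) F(2)
    by (intro integral_dominated_convergence[where w="\<lambda>x. 4 * (f x)\<^sup>2"])
      (auto intro!: tendsto_intros)
  have lim2: "(\<lambda>n. \<integral>x. (F n x - f x)\<^sup>2 \<partial>\<mu>) \<longlonglongrightarrow> (\<integral>x. 0 \<partial>\<mu>)"
  proof (intro integral_dominated_convergence[where w="\<lambda>x. 9 * (f x)\<^sup>2"])
    show "AE x in \<mu>. (\<lambda>n. (F n x - f x)\<^sup>2) \<longlonglongrightarrow> 0"
    proof (rule AE_I2)
      fix x assume "x \<in> space \<mu>"
      from tendsto_power[OF tendsto_diff[OF F(2)[OF this] tendsto_const[of "f x"]], of 2]
      show "(\<lambda>n. (F n x - f x)\<^sup>2) \<longlonglongrightarrow> 0" by simp
    qed
  qed (use f2 le(2) in auto)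
  show ?thesis
  proof (rule centered_normalI_char)
    fix t :: real
    have "(\<lambda>n. char (distr M borel (I (F n))) t) \<longlonglongrightarrow> char (distr M borel (I f)) t"
    proof (rule Lim_transform2[OF tendsto_const])
      have "(\<lambda>n. char (distr M borel (I (F n))) t - char (distr M borel (I f)) t) \<longlonglongrightarrow> 0"
      proof (rule Lim_null_comparison)
        show "\<forall>\<^sub>F n in sequentially. cmod (char (distr M borel (I (F n))) t - char (distr M borel (I f)) t)
          \<le> \<bar>t\<bar> * sqrt (\<integral>x. (F n x - f x)\<^sup>2 \<partial>\<mu>)"
          using char_diff_le[OF I_measurable[OF Fsq] I_measurable[OF f] I_diff_second_moment(1)[OF Fsq f], where t=t]
          by (auto simp: I_diff_second_moment(2)[OF Fsq f])
        show "(\<lambda>n. \<bar>t\<bar> * sqrt (\<integral>x. (F n x - f x)\<^sup>2 \<partial>\<mu>)) \<longlonglongrightarrow> 0"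
          using tendsto_mult[OF tendsto_const tendsto_real_sqrt[OF lim2]] by simp
      qed
      from tendsto_minus[OF this]
      show "(\<lambda>n. char (distr M borel (I f)) t - char (distr M borel (I (F n))) t) \<longlonglongrightarrow> 0" by simp
    qed
    moreover have "(\<lambda>n. char (distr M borel (I (F n))) t) \<longlonglongrightarrow> complex_of_real (exp (- ((\<integral>x. (f x)\<^sup>2 \<partial>\<mu>) * t\<^sup>2) / 2))"
      unfolding char_centered_normal[OF I_simple_centered_normal[OF F(1) Fsq]]
      by (intro tendsto_intros lim1) auto
    ultimately show "char (distr M borel (I f)) t = complex_of_real (exp (- ((\<integral>x. (f x)\<^sup>2 \<partial>\<mu>) * t\<^sup>2) / 2))"
      by (rule LIMSEQ_unique)
  qed (use f in auto)
qed

text \<open>A linear combination of Wiener integrals is almost surely the Wiener integral of the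
  combination. Its variance is the quadratic form of the Gram matrix, so the law depends on the
  covariances alone.\<close>

lemma I_sum_centered_normal:
  assumes "finite J" "\<And>i. i \<in> J \<Longrightarrow> square_integrable \<mu> (f i)"
  shows "centered_normal M (\<lambda>\<omega>. \<Sum>i\<in>J. c i * I (f i) \<omega>)
    (\<Sum>i\<in>J. \<Sum>j\<in>J. c i * c j * (\<integral>x. f i x * f j x \<partial>\<mu>))"
proof -
  let ?g = "\<lambda>x. \<Sum>i\<in>J. c i * f i x"
  have sq: "square_integrable \<mu> ?g"
    using assms by (intro square_integrable_sum)
  have "(\<integral>x. (?g x)\<^sup>2 \<partial>\<mu>) = (\<integral>x. (\<Sum>i\<in>J. \<Sum>j\<in>J. c i * c j * (f i x * f j x)) \<partial>\<mu>)"
    by (simp add: power2_eq_square sum_product mult_ac)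
  also have "\<dots> = (\<Sum>i\<in>J. \<Sum>j\<in>J. c i * c j * (\<integral>x. f i x * f j x \<partial>\<mu>))"
  proof -
    have int: "integrable \<mu> (\<lambda>x. c i * c j * (f i x * f j x))" if "i \<in> J" "j \<in> J" for i j
      using assms(2) that by (intro integrable_mult_right square_integrable_mult)
    have "(\<integral>x. (\<Sum>i\<in>J. \<Sum>j\<in>J. c i * c j * (f i x * f j x)) \<partial>\<mu>) =
      (\<Sum>i\<in>J. \<integral>x. (\<Sum>j\<in>J. c i * c j * (f i x * f j x)) \<partial>\<mu>)"
      by (intro Bochner_Integration.integral_sum Bochner_Integration.integrable_sum int)
    also have "\<dots> = (\<Sum>i\<in>J. \<Sum>j\<in>J. c i * c j * (\<integral>x. f i x * f j x \<partial>\<mu>))"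
      by (intro sum.cong refl, subst Bochner_Integration.integral_sum) (auto intro: square_integrable_mult assms(2))
    finally show ?thesis .
  qed
  finally show ?thesis
    using centered_normal_cong_AE[OF I_centered_normal[OF sq] I_sum[OF assms]] assms by simp
qed

end

section \<open>Joint laws are determined by linear combinations\<close>

context prob_space
begin

lemma integrable_bounded_weight:
  fixes g :: "'a \<Rightarrow> real"
  assumes [measurable]: "random_variable borel g" and "\<And>\<omega>. \<bar>g \<omega>\<bar> \<le> C"
  shows "integrable M g"
  using assms(2) by (intro integrable_const_bound[of _ C]) auto

lemma integrable_weight_iexp:
  fixes g X :: "'a \<Rightarrow> real"
  assumes [measurable]: "random_variable borel g" "random_variable borel X" and "\<And>\<omega>. \<bar>g \<omega>\<bar> \<le> C"
  shows "integrable M (\<lambda>\<omega>. complex_of_real (g \<omega>) * iexp (X \<omega>))"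
  using assms(3) by (intro integrable_const_bound[of _ C]) (auto simp: norm_mult)

text \<open>After division by its total mass c, the weight g is a probability density, and the
  weighted expectation of \<open>iexp (t * X \<omega>)\<close> is c times the characteristic
  function of X under the new measure; Levy's uniqueness theorem applies. Taking t = 0 shows that
  both weights have the same mass.\<close>

lemma weighted_law_unique:
  fixes g g' X X' :: "'a \<Rightarrow> real"
  assumes [measurable]: "random_variable borel g" "random_variable borel g'"
      "random_variable borel X" "random_variable borel X'" "B \<in> sets borel"
    and nonneg: "\<And>\<omega>. 0 \<le> g \<omega>" "\<And>\<omega>. 0 \<le> g' \<omega>"
    and bound: "\<And>\<omega>. \<bar>g \<omega>\<bar> \<le> C" "\<And>\<omega>. \<bar>g' \<omega>\<bar> \<le> C"
    and char: "\<And>t. (CLINT \<omega>|M. complex_of_real (g \<omega>) * iexp (t * X \<omega>)) =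
      (CLINT \<omega>|M. complex_of_real (g' \<omega>) * iexp (t * X' \<omega>))"
  shows "(\<integral>\<omega>. g \<omega> * indicator B (X \<omega>) \<partial>M) = (\<integral>\<omega>. g' \<omega> * indicator B (X' \<omega>) \<partial>M)"
proof -
  note [simp] = integrable_bounded_weight[OF assms(1) bound(1)] integrable_bounded_weight[OF assms(2) bound(2)]
  define c where "c = (\<integral>\<omega>. g \<omega> \<partial>M)"
  have c': "c = (\<integral>\<omega>. g' \<omega> \<partial>M)"
    using char[of 0] by (simp add: c_def)
  have "0 \<le> c" unfolding c_def using nonneg by simp
  show ?thesis
  proof (cases "c = 0")
    \<comment> \<open>Without mass there is nothing to normalize, but then both weights vanish
      almost surely.\<close>
    case True
    have "AE \<omega> in M. g \<omega> = 0" "AE \<omega> in M. g' \<omega> = 0"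
      using True c' nonneg integral_nonneg_eq_0_iff_AE[of M g] integral_nonneg_eq_0_iff_AE[of M g']
      by (auto simp: c_def)
    then have "(\<integral>\<omega>. g \<omega> * indicator B (X \<omega>) \<partial>M) = (\<integral>\<omega>. 0 \<partial>M)"
      "(\<integral>\<omega>. g' \<omega> * indicator B (X' \<omega>) \<partial>M) = (\<integral>\<omega>. 0 \<partial>M)"
      by (intro integral_cong_AE; auto)+
    then show ?thesis by simp
  next
    case False
    with \<open>0 \<le> c\<close> have c: "0 < c" by simp
    define N where "N h Y = distr (density M (\<lambda>\<omega>. ennreal (h \<omega> / c))) borel Y" for h Y :: "'a \<Rightarrow> real"
    have N: "real_distribution (N h Y)"
      "char (N h Y) t = (CLINT \<omega>|M. complex_of_real (h \<omega>) * iexp (t * Y \<omega>)) / c"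
      "(\<integral>x. indicator B x \<partial>N h Y) = (\<integral>\<omega>. h \<omega> * indicator B (Y \<omega>) \<partial>M) / c"
      if [measurable]: "random_variable borel h" "random_variable borel Y"
        and h: "\<And>\<omega>. 0 \<le> h \<omega>" "integrable M h" "(\<integral>\<omega>. h \<omega> \<partial>M) = c" for h Y t
    proof -
      have "emeasure (density M (\<lambda>\<omega>. ennreal (h \<omega> / c))) (space M) = (\<integral>\<^sup>+\<omega>. ennreal (h \<omega> / c) \<partial>M)"
        by (subst emeasure_density) (auto intro!: nn_integral_cong)
      also have "\<dots> = ennreal (\<integral>\<omega>. h \<omega> / c \<partial>M)"
        using h c by (intro nn_integral_eq_integral) auto
      also have "\<dots> = 1" using h c by simp
      finally interpret D: prob_space "density M (\<lambda>\<omega>. ennreal (h \<omega> / c))"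
        by (intro prob_spaceI) simp
      show "real_distribution (N h Y)"
        unfolding N_def by (rule D.real_distribution_distr) simp
      show "char (N h Y) t = (CLINT \<omega>|M. complex_of_real (h \<omega>) * iexp (t * Y \<omega>)) / c"
        unfolding N_def char_def using h c
        by (simp add: integral_distr integral_density scaleR_conv_of_real)
      show "(\<integral>x. indicator B x \<partial>N h Y) = (\<integral>\<omega>. h \<omega> * indicator B (Y \<omega>) \<partial>M) / c"
      proof -
        have "(\<integral>x. indicator B x \<partial>N h Y) = (\<integral>\<omega>. indicat_real B (Y \<omega>) \<partial>density M (\<lambda>\<omega>. ennreal (h \<omega> / c)))"
          unfolding N_def by (subst integral_distr) auto
        also have "\<dots> = (\<integral>\<omega>. (h \<omega> / c) *\<^sub>R indicator B (Y \<omega>) \<partial>M)"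
          using h c by (subst integral_density) auto
        finally show ?thesis by simp
      qed
    qed
    have "N g X = N g' X'"
      by (rule Levy_uniqueness) (use char nonneg c' in \<open>auto simp: N c_def fun_eq_iff\<close>)
    have "(\<integral>\<omega>. g \<omega> * indicator B (X \<omega>) \<partial>M) / c = (\<integral>x. indicator B x \<partial>N g X)"
      by (rule N(3)[symmetric]) (use nonneg in \<open>auto simp: c_def\<close>)
    also have "\<dots> = (\<integral>x. indicator B x \<partial>N g' X')"
      by (simp only: \<open>N g X = N g' X'\<close>)
    also have "\<dots> = (\<integral>\<omega>. g' \<omega> * indicator B (X' \<omega>) \<partial>M) / c"
      by (rule N(3)) (use nonneg c' in auto)
    finally show ?thesis using c by simp
  qed
qed

text \<open>Levy's uniqueness theorem needs nonnegative weights, so the oscillating factor is used in the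
  form \<open>1 + cos (\<Theta> - a)\<close>.\<close>

lemma oscillating_law_unique:
  fixes g g' X X' \<Theta> \<Theta>' :: "'a \<Rightarrow> real"
  assumes [measurable]: "random_variable borel g" "random_variable borel g'"
      "random_variable borel X" "random_variable borel X'"
      "random_variable borel \<Theta>" "random_variable borel \<Theta>'" "B \<in> sets borel"
    and nonneg: "\<And>\<omega>. 0 \<le> g \<omega>" "\<And>\<omega>. 0 \<le> g' \<omega>"
    and bound: "\<And>\<omega>. \<bar>g \<omega>\<bar> \<le> 1" "\<And>\<omega>. \<bar>g' \<omega>\<bar> \<le> 1"
    and char: "\<And>s t. (CLINT \<omega>|M. complex_of_real (g \<omega>) * iexp (s * \<Theta> \<omega> + t * X \<omega>)) =
      (CLINT \<omega>|M. complex_of_real (g' \<omega>) * iexp (s * \<Theta>' \<omega> + t * X' \<omega>))"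
  shows "(CLINT \<omega>|M. complex_of_real (g \<omega> * indicator B (X \<omega>)) * iexp (\<Theta> \<omega>)) =
      (CLINT \<omega>|M. complex_of_real (g' \<omega> * indicator B (X' \<omega>)) * iexp (\<Theta>' \<omega>))"
proof -
  \<comment> \<open>The weight 1 + cos is a sum of exponentials with frequencies 0, 1 and -1 in S,
    so the hypothesis is used at exactly these three values of s.\<close>
  have expand: "(CLINT \<omega>|M. complex_of_real (h \<omega> * (1 + cos (S \<omega> - a))) * iexp (t * Y \<omega>)) =
      (CLINT \<omega>|M. complex_of_real (h \<omega>) * iexp (0 * S \<omega> + t * Y \<omega>)) +
      iexp (- a) / 2 * (CLINT \<omega>|M. complex_of_real (h \<omega>) * iexp (1 * S \<omega> + t * Y \<omega>)) +
      iexp a / 2 * (CLINT \<omega>|M. complex_of_real (h \<omega>) * iexp (- 1 * S \<omega> + t * Y \<omega>))"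
    if [measurable]: "random_variable borel h" "random_variable borel S" "random_variable borel Y"
      and "\<And>\<omega>. \<bar>h \<omega>\<bar> \<le> 1" for h S Y :: "'a \<Rightarrow> real" and a t
  proof -
    have "complex_of_real (h \<omega> * (1 + cos (S \<omega> - a))) * iexp (t * Y \<omega>) =
      complex_of_real (h \<omega>) * iexp (0 * S \<omega> + t * Y \<omega>) +
      iexp (- a) / 2 * (complex_of_real (h \<omega>) * iexp (1 * S \<omega> + t * Y \<omega>)) +
      iexp a / 2 * (complex_of_real (h \<omega>) * iexp (- 1 * S \<omega> + t * Y \<omega>))" for \<omega>
    proof -
      have "complex_of_real (cos (S \<omega> - a)) = (iexp (S \<omega> - a) + iexp (- (S \<omega> - a))) / 2"
      proof -
        have "- (\<i> * (complex_of_real (S \<omega>) - complex_of_real a)) = \<i> * (complex_of_real a - complex_of_real (S \<omega>))"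
          by (simp add: algebra_simps)
        then show ?thesis by (simp add: cos_of_real[symmetric] cos_exp_eq)
      qed
      also have "\<dots> = (iexp (- a) * iexp (S \<omega>) + iexp a * iexp (- S \<omega>)) / 2"
        by (simp add: algebra_simps flip: exp_add)
      finally have c: "complex_of_real (cos (S \<omega> - a)) = \<dots>" .
      have e: "iexp (1 * S \<omega> + t * Y \<omega>) = iexp (S \<omega>) * iexp (t * Y \<omega>)"
        "iexp (- 1 * S \<omega> + t * Y \<omega>) = iexp (- S \<omega>) * iexp (t * Y \<omega>)"
        "iexp (0 * S \<omega> + t * Y \<omega>) = iexp (t * Y \<omega>)"
        by (simp_all add: algebra_simps flip: exp_add)
      show ?thesis
        unfolding e
        by (simp only: of_real_mult[of "h \<omega>"] of_real_add[of 1] of_real_1 c)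
          (simp add: algebra_simps add_divide_distrib)
    qed
    note pointwise = this
    define G where "G s \<omega> = complex_of_real (h \<omega>) * iexp (s * S \<omega> + t * Y \<omega>)" for s \<omega>
    have "integrable M (G s)" for s
      unfolding G_def using that(4) by (intro integrable_weight_iexp) auto
    then show ?thesis
      unfolding pointwise G_def[symmetric] by simp
  qed
  have cos_eq: "(\<integral>\<omega>. g \<omega> * indicator B (X \<omega>) * cos (\<Theta> \<omega> - a) \<partial>M) =
      (\<integral>\<omega>. g' \<omega> * indicator B (X' \<omega>) * cos (\<Theta>' \<omega> - a) \<partial>M)" for a
  proof -
    have cos0: "0 \<le> 1 + cos x" and cos2: "\<bar>1 + cos x\<bar> \<le> 2" for x :: real
      using cos_ge_minus_one[of x] cos_le_one[of x] by linarith+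
    have b: "\<bar>h * (1 + cos x)\<bar> \<le> 2" if "\<bar>h\<bar> \<le> 1" for h x :: real
      using mult_mono[OF that cos2] by (simp add: abs_mult)
    have "(\<integral>\<omega>. g \<omega> * (1 + cos (\<Theta> \<omega> - a)) * indicator B (X \<omega>) \<partial>M) =
        (\<integral>\<omega>. g' \<omega> * (1 + cos (\<Theta>' \<omega> - a)) * indicator B (X' \<omega>) \<partial>M)"
    proof (rule weighted_law_unique[where C=2])
      show "(CLINT \<omega>|M. complex_of_real (g \<omega> * (1 + cos (\<Theta> \<omega> - a))) * iexp (t * X \<omega>)) =
        (CLINT \<omega>|M. complex_of_real (g' \<omega> * (1 + cos (\<Theta>' \<omega> - a))) * iexp (t * X' \<omega>))" for t
        by (simp only: expand[OF assms(1,5,3) bound(1)] expand[OF assms(2,6,4) bound(2)] char)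
      show "\<bar>g \<omega> * (1 + cos (\<Theta> \<omega> - a))\<bar> \<le> 2" "\<bar>g' \<omega> * (1 + cos (\<Theta>' \<omega> - a))\<bar> \<le> 2" for \<omega>
        by (rule b[OF bound(1)] b[OF bound(2)])+
    qed (use nonneg cos0 in auto)
    \<comment> \<open>Subtracting the same identity for the plain weight removes the summand 1 and
      leaves the cosine.\<close>
    moreover have "(\<integral>\<omega>. g \<omega> * indicator B (X \<omega>) \<partial>M) = (\<integral>\<omega>. g' \<omega> * indicator B (X' \<omega>) \<partial>M)"
    proof (rule weighted_law_unique[where C=1])
      show "(CLINT \<omega>|M. complex_of_real (g \<omega>) * iexp (t * X \<omega>)) =
        (CLINT \<omega>|M. complex_of_real (g' \<omega>) * iexp (t * X' \<omega>))" for t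
        using char[of 0 t] by simp
    qed (use nonneg bound in auto)
    moreover have "(\<integral>\<omega>. h \<omega> * (1 + cos (S \<omega> - a)) * indicator B (Y \<omega>) \<partial>M) =
      (\<integral>\<omega>. h \<omega> * indicator B (Y \<omega>) \<partial>M) + (\<integral>\<omega>. h \<omega> * indicator B (Y \<omega>) * cos (S \<omega> - a) \<partial>M)"
      if [measurable]: "random_variable borel h" "random_variable borel S" "random_variable borel Y"
        and h: "\<And>\<omega>. \<bar>h \<omega>\<bar> \<le> 1" for h S Y :: "'a \<Rightarrow> real"
    proof -
      have hi: "\<bar>h \<omega> * indicator B (Y \<omega>)\<bar> \<le> 1" for \<omega>
        using h[of \<omega>] by (simp add: indicator_def)
      have "\<bar>h \<omega> * indicator B (Y \<omega>) * cos (S \<omega> - a)\<bar> \<le> 1 * 1" for \<omega>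
        unfolding abs_mult[of "h \<omega> * indicator B (Y \<omega>)"] using hi by (intro mult_mono) auto
      then have "integrable M (\<lambda>\<omega>. h \<omega> * indicator B (Y \<omega>))"
        "integrable M (\<lambda>\<omega>. h \<omega> * indicator B (Y \<omega>) * cos (S \<omega> - a))"
        using hi by (auto intro!: integrable_bounded_weight[where C=1])
      then show ?thesis
        by (subst Bochner_Integration.integral_add[symmetric]) (auto simp: algebra_simps)
    qed
    ultimately show ?thesis using bound by simp
  qed
  \<comment> \<open>The phases 0 and pi/2 give cosine and sine, that is, real and imaginary
    part.\<close>
  have split: "(CLINT \<omega>|M. complex_of_real (h \<omega>) * iexp (S \<omega>)) =
    complex_of_real (\<integral>\<omega>. h \<omega> * cos (S \<omega> - 0) \<partial>M) + \<i> * complex_of_real (\<integral>\<omega>. h \<omega> * cos (S \<omega> - pi / 2) \<partial>M)"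
    if [measurable]: "random_variable borel h" "random_variable borel S"
      and h: "\<And>\<omega>. \<bar>h \<omega>\<bar> \<le> 1" for h S :: "'a \<Rightarrow> real"
  proof -
    have "integrable M (\<lambda>\<omega>. h \<omega> * cos (S \<omega> - a))" for a
    proof (rule integrable_bounded_weight[where C="1 * 1"])
      show "\<bar>h \<omega> * cos (S \<omega> - a)\<bar> \<le> 1 * 1" for \<omega>
        unfolding abs_mult using h by (intro mult_mono) auto
    qed simp
    note int = this[of 0] this[of "pi / 2"]
    have "(CLINT \<omega>|M. complex_of_real (h \<omega>) * iexp (S \<omega>)) =
      (CLINT \<omega>|M. complex_of_real (h \<omega> * cos (S \<omega> - 0)) + \<i> * complex_of_real (h \<omega> * cos (S \<omega> - pi / 2)))"
      by (intro Bochner_Integration.integral_cong refl)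
        (simp add: exp_Euler cos_diff ring_distribs flip: cos_of_real sin_of_real)
    also have "\<dots> = (CLINT \<omega>|M. complex_of_real (h \<omega> * cos (S \<omega> - 0))) +
        \<i> * (CLINT \<omega>|M. complex_of_real (h \<omega> * cos (S \<omega> - pi / 2)))"
      using int by (subst Bochner_Integration.integral_add)
        (auto intro!: integrable_of_real simp del: of_real_mult)
    finally show ?thesis by (simp only: integral_complex_of_real)
  qed
  have b: "\<bar>g \<omega> * indicator B (X \<omega>)\<bar> \<le> 1" "\<bar>g' \<omega> * indicator B (X' \<omega>)\<bar> \<le> 1" for \<omega>
    using bound[of \<omega>] by (auto simp: indicator_def)
  have m: "random_variable borel (\<lambda>\<omega>. g \<omega> * indicator B (X \<omega>))"
    "random_variable borel (\<lambda>\<omega>. g' \<omega> * indicator B (X' \<omega>))"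
    by measurable
  show ?thesis
    unfolding split[OF m(1) assms(5) b(1)] split[OF m(2) assms(6) b(2)] cos_eq ..
qed

text \<open>This is the Cramer-Wold principle, obtained from one-dimensional uniqueness. In
  \<open>partial\<close> the coordinates in K carry indicators and the others exponentials: K empty
  is the hypothesis, K = J is agreement on boxes, and boxes determine a finite measure on the
  product.\<close>

lemma joint_law_unique:
  fixes X Y :: "'i \<Rightarrow> 'a \<Rightarrow> real"
  assumes "finite J"
    and X: "\<And>j. j \<in> J \<Longrightarrow> random_variable borel (X j)"
    and Y: "\<And>j. j \<in> J \<Longrightarrow> random_variable borel (Y j)"
    and char: "\<And>t. (CLINT \<omega>|M. iexp (\<Sum>j\<in>J. t j * X j \<omega>)) = (CLINT \<omega>|M. iexp (\<Sum>j\<in>J. t j * Y j \<omega>))"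
  shows "distr M (PiM J (\<lambda>_. borel)) (\<lambda>\<omega>. \<lambda>j\<in>J. X j \<omega>) = distr M (PiM J (\<lambda>_. borel)) (\<lambda>\<omega>. \<lambda>j\<in>J. Y j \<omega>)"
proof -
  have partial: "(CLINT \<omega>|M. complex_of_real (\<Prod>j\<in>K. indicator (B j) (X j \<omega>)) * iexp (\<Sum>j\<in>J-K. t j * X j \<omega>)) =
      (CLINT \<omega>|M. complex_of_real (\<Prod>j\<in>K. indicator (B j) (Y j \<omega>)) * iexp (\<Sum>j\<in>J-K. t j * Y j \<omega>))"
    if "K \<subseteq> J" and B: "\<And>j. j \<in> J \<Longrightarrow> B j \<in> sets borel" for K B t
    using finite_subset[OF \<open>K \<subseteq> J\<close> \<open>finite J\<close>] \<open>K \<subseteq> J\<close>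
  proof (induction K arbitrary: t rule: finite_induct)
    case empty
    then show ?case using char by simp
  next
    case (insert k K)
    then have k: "k \<in> J" "k \<notin> K" "K \<subseteq> J" "finite K" by auto
    have J: "J - K = insert k (J - insert k K)" using k by auto
    have ind[measurable]: "(\<lambda>\<omega>. \<Prod>j\<in>K. indicator (B j) (Z j \<omega>) :: real) \<in> borel_measurable M"
      "(\<lambda>\<omega>. \<Sum>j\<in>J - insert k K. t j * Z j \<omega>) \<in> borel_measurable M"
      if "\<And>j. j \<in> J \<Longrightarrow> random_variable borel (Z j)" for Z :: "'i \<Rightarrow> 'a \<Rightarrow> real"
      using k that B
      by (auto intro!: borel_measurable_prod borel_measurable_sum borel_measurable_times
          measurable_compose[OF _ borel_measurable_indicator])
    have bnd: "0 \<le> (\<Prod>j\<in>K. indicator (B j) (Z j) :: real)" "\<bar>\<Prod>j\<in>K. indicator (B j) (Z j) :: real\<bar> \<le> 1"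
      for Z :: "'i \<Rightarrow> real"
      by (auto intro!: prod_nonneg prod_le_1 simp: abs_prod)
    have "(CLINT \<omega>|M. complex_of_real ((\<Prod>j\<in>K. indicator (B j) (X j \<omega>)) * indicator (B k) (X k \<omega>)) *
         iexp (\<Sum>j\<in>J - insert k K. t j * X j \<omega>)) =
      (CLINT \<omega>|M. complex_of_real ((\<Prod>j\<in>K. indicator (B j) (Y j \<omega>)) * indicator (B k) (Y k \<omega>)) *
         iexp (\<Sum>j\<in>J - insert k K. t j * Y j \<omega>))"
    proof (rule oscillating_law_unique)
      fix s r :: real
      \<comment> \<open>The induction hypothesis is needed for all frequencies: coordinate k gets
        the free frequency r, the other remaining ones are scaled jointly by s, which makes their
        sum the phase of the oscillating factor.\<close>
      have "(\<Sum>j\<in>J-K. (if j = k then r else s * t j) * Z j \<omega>) =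
        s * (\<Sum>j\<in>J - insert k K. t j * Z j \<omega>) + r * Z k \<omega>" for Z :: "'i \<Rightarrow> 'a \<Rightarrow> real" and \<omega>
        unfolding J using \<open>finite J\<close>
        by (subst sum.insert) (auto simp: sum_distrib_left mult.assoc intro!: sum.cong)
      then show "(CLINT \<omega>|M. complex_of_real (\<Prod>j\<in>K. indicator (B j) (X j \<omega>)) *
          iexp (s * (\<Sum>j\<in>J - insert k K. t j * X j \<omega>) + r * X k \<omega>)) =
        (CLINT \<omega>|M. complex_of_real (\<Prod>j\<in>K. indicator (B j) (Y j \<omega>)) *
          iexp (s * (\<Sum>j\<in>J - insert k K. t j * Y j \<omega>) + r * Y k \<omega>))"
        using insert.IH[OF k(3), of "\<lambda>j. if j = k then r else s * t j"] by (simp only:)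
    qed (use k X Y B bnd ind[of X] ind[of Y] in auto)
    then show ?case by (simp only: prod.insert[OF k(4,2)] mult.commute)
  qed
  have cyl: "(\<integral>\<omega>. (\<Prod>j\<in>J. indicator (B j) (X j \<omega>)) \<partial>M) = (\<integral>\<omega>. (\<Prod>j\<in>J. indicator (B j) (Y j \<omega>)) \<partial>M :: real)"
    if "\<And>j. j \<in> J \<Longrightarrow> B j \<in> sets borel" for B
    using partial[of J B, OF subset_refl that]
    by (simp add: integral_complex_of_real del: of_real_prod)
  have em: "emeasure (distr M (PiM J (\<lambda>_. borel)) (\<lambda>\<omega>. \<lambda>j\<in>J. Z j \<omega>)) (Pi\<^sub>E J B) =
      ennreal (\<integral>\<omega>. (\<Prod>j\<in>J. indicator (B j) (Z j \<omega>)) \<partial>M)"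
    if Z: "\<And>j. j \<in> J \<Longrightarrow> random_variable borel (Z j)" and B: "\<And>j. j \<in> J \<Longrightarrow> B j \<in> sets borel"
    for Z :: "'i \<Rightarrow> 'a \<Rightarrow> real" and B
  proof -
    have m: "(\<lambda>\<omega>. \<lambda>j\<in>J. Z j \<omega>) \<in> measurable M (PiM J (\<lambda>_. borel))"
      using Z by (rule measurable_restrict)
    have S: "Pi\<^sub>E J B \<in> sets (PiM J (\<lambda>_. borel))"
      using \<open>finite J\<close> B by (intro sets_PiM_I_finite)
    let ?A = "(\<lambda>\<omega>. \<lambda>j\<in>J. Z j \<omega>) -` Pi\<^sub>E J B \<inter> space M"
    have "emeasure (distr M (PiM J (\<lambda>_. borel)) (\<lambda>\<omega>. \<lambda>j\<in>J. Z j \<omega>)) (Pi\<^sub>E J B) = emeasure M ?A"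
      using m S by (rule emeasure_distr)
    also have "\<dots> = ennreal (\<integral>\<omega>. indicator ?A \<omega> \<partial>M)"
      using measurable_sets[OF m S] by (simp add: emeasure_eq_measure)
    also have "(\<integral>\<omega>. indicator ?A \<omega> \<partial>M) = (\<integral>\<omega>. (\<Prod>j\<in>J. indicator (B j) (Z j \<omega>)) \<partial>M :: real)"
    proof (intro Bochner_Integration.integral_cong refl)
      fix \<omega> assume "\<omega> \<in> space M"
      have "(\<Prod>j\<in>J. indicator (B j) (Z j \<omega>)) = (if \<forall>j\<in>J. Z j \<omega> \<in> B j then 1 else 0 :: real)"
      proof (cases "\<forall>j\<in>J. Z j \<omega> \<in> B j")
        case False
        then have "\<exists>j\<in>J. indicat_real (B j) (Z j \<omega>) = 0" by (auto simp: indicator_def)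
        then show ?thesis using False \<open>finite J\<close> by (simp add: prod_zero)
      qed simp
      then show "indicator ?A \<omega> = (\<Prod>j\<in>J. indicator (B j) (Z j \<omega>) :: real)"
        using \<open>\<omega> \<in> space M\<close> by (auto simp: indicator_def PiE_iff)
    qed
    finally show ?thesis .
  qed
  show ?thesis
  proof (rule measure_eqI_PiM_finite[where M="\<lambda>_. borel" and A="\<lambda>_. space (PiM J (\<lambda>_. borel))"])
    show "finite J" by fact
    show "range (\<lambda>_::nat. space (PiM J (\<lambda>_. borel :: real measure))) \<subseteq> prod_algebra J (\<lambda>_. borel)"
      using \<open>finite J\<close> by (auto simp: space_PiM intro!: prod_algebraI_finite)
    show "emeasure (distr M (PiM J (\<lambda>_. borel)) (\<lambda>\<omega>. \<lambda>j\<in>J. X j \<omega>)) (space (PiM J (\<lambda>_. borel))) \<noteq> \<infinity>"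
      using em[of X "\<lambda>_. UNIV"] X by (simp add: space_PiM)
  qed (auto simp: em X Y cyl)
qed

lemma joint_law_unique_centered_normal:
  fixes X Y :: "'i \<Rightarrow> 'a \<Rightarrow> real"
  assumes "finite J"
    and "\<And>j. j \<in> J \<Longrightarrow> random_variable borel (X j)" "\<And>j. j \<in> J \<Longrightarrow> random_variable borel (Y j)"
    and n: "\<And>t. centered_normal M (\<lambda>\<omega>. \<Sum>j\<in>J. t j * X j \<omega>) (s t)"
      "\<And>t. centered_normal M (\<lambda>\<omega>. \<Sum>j\<in>J. t j * Y j \<omega>) (s t)"
  shows "distr M (PiM J (\<lambda>_. borel)) (\<lambda>\<omega>. \<lambda>j\<in>J. X j \<omega>) = distr M (PiM J (\<lambda>_. borel)) (\<lambda>\<omega>. \<lambda>j\<in>J. Y j \<omega>)"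
proof (rule joint_law_unique)
  fix t
  have "random_variable borel (\<lambda>\<omega>. \<Sum>j\<in>J. t j * X j \<omega>)" "random_variable borel (\<lambda>\<omega>. \<Sum>j\<in>J. t j * Y j \<omega>)"
    using n by (simp_all add: centered_normal_def)
  from this[THEN char_distr_eq, of 1] show
    "(CLINT \<omega>|M. iexp (\<Sum>j\<in>J. t j * X j \<omega>)) = (CLINT \<omega>|M. iexp (\<Sum>j\<in>J. t j * Y j \<omega>))"
    using char_centered_normal[OF n(1), of t 1] char_centered_normal[OF n(2), of t 1] by simp
qed fact+

end

section \<open>Hoelder continuous versions\<close>

definition dyadic_floor :: "nat \<Rightarrow> real \<Rightarrow> real" where
  "dyadic_floor n u = real_of_int \<lfloor>2 ^ n * u\<rfloor> / 2 ^ n"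

lemma dyadic_floor_bounds: "dyadic_floor n u \<le> u" "u - dyadic_floor n u \<le> 1 / 2 ^ n"
proof -
  have "real_of_int \<lfloor>2 ^ n * u\<rfloor> \<le> 2 ^ n * u" "2 ^ n * u \<le> real_of_int \<lfloor>2 ^ n * u\<rfloor> + 1"
    by linarith+
  then have "real_of_int \<lfloor>2 ^ n * u\<rfloor> / 2 ^ n \<le> u" "u \<le> (real_of_int \<lfloor>2 ^ n * u\<rfloor> + 1) / 2 ^ n"
    by (simp_all add: pos_divide_le_eq pos_le_divide_eq mult.commute)
  then show "dyadic_floor n u \<le> u" "u - dyadic_floor n u \<le> 1 / 2 ^ n"
    by (simp_all add: dyadic_floor_def add_divide_distrib)
qed

lemma floor_scaled_bound:
  assumes "\<bar>u\<bar> \<le> real N"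
  shows "\<bar>\<lfloor>2 ^ n * u\<rfloor>\<bar> \<le> int N * 2 ^ n"
proof -
  have "2 ^ n * u \<le> 2 ^ n * real N" "2 ^ n * (- real N) \<le> 2 ^ n * u"
    using assms by (intro mult_left_mono; simp; linarith)+
  then have "2 ^ n * u \<le> of_int (int N * 2 ^ n)" "of_int (- (int N * 2 ^ n)) \<le> 2 ^ n * u"
    by (simp_all add: mult.commute)
  then have "\<lfloor>2 ^ n * u\<rfloor> \<le> int N * 2 ^ n" "- (int N * 2 ^ n) \<le> \<lfloor>2 ^ n * u\<rfloor>"
    by (auto simp only: le_floor_iff) linarith
  then show ?thesis by linarith
qed

text \<open>The deterministic half of the Kolmogorov-Chentsov argument, for a single path f: steps
  between neighbouring dyadic points of mesh \<open>1 / 2 ^ n\<close> are at most K times the mesh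
  to the power \<alpha>. The inclusive range of k makes \<open>\<lfloor>2 ^ n * u\<rfloor>\<close>
  an admissible index for every u between -N and N.\<close>

locale dyadic_increments =
  fixes f :: "real \<Rightarrow> real" and \<alpha> K :: real and N :: nat
  assumes \<alpha>: "0 < \<alpha>" and K: "0 \<le> K"
    and inc: "\<And>n k. \<bar>k :: int\<bar> \<le> int N * 2 ^ n \<Longrightarrow>
      \<bar>f (real_of_int (k + 1) / 2 ^ n) - f (real_of_int k / 2 ^ n)\<bar> \<le> K * (2 powr - \<alpha>) ^ n"
begin

abbreviation "\<rho> \<equiv> (2::real) powr - \<alpha>"

lemma \<rho>: "0 < \<rho>" "\<rho> < 1"
  using \<alpha> by (auto simp: powr_less_one)

text \<open>Passing to the next level turns the index m into 2m or 2m + 1, so the dyadic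
  approximation stays put or makes one step of the finer grid.\<close>

lemma dyadic_floor_step:
  assumes "\<bar>u\<bar> \<le> real N"
  shows "\<bar>f (dyadic_floor (Suc n) u) - f (dyadic_floor n u)\<bar> \<le> K * \<rho> ^ Suc n"
proof -
  let ?m = "\<lfloor>2 ^ n * u\<rfloor>"
  have "real_of_int ?m \<le> 2 ^ n * u" "2 ^ n * u < real_of_int ?m + 1" by linarith+
  then have "real_of_int (2 * ?m) \<le> 2 ^ Suc n * u" "2 ^ Suc n * u < real_of_int (2 * ?m + 2)"
    by (simp_all add: algebra_simps)
  then have "\<lfloor>2 ^ Suc n * u\<rfloor> = 2 * ?m \<or> \<lfloor>2 ^ Suc n * u\<rfloor> = 2 * ?m + 1" by linarith
  then show ?thesis
  proof
    assume "\<lfloor>2 ^ Suc n * u\<rfloor> = 2 * ?m"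
    then have "dyadic_floor (Suc n) u = dyadic_floor n u"
      unfolding dyadic_floor_def by simp
    then show ?thesis using K \<rho> by simp
  next
    assume "\<lfloor>2 ^ Suc n * u\<rfloor> = 2 * ?m + 1"
    then have "dyadic_floor (Suc n) u = real_of_int (2 * ?m + 1) / 2 ^ Suc n"
      unfolding dyadic_floor_def by simp
    moreover have "dyadic_floor n u = real_of_int (2 * ?m) / 2 ^ Suc n"
      unfolding dyadic_floor_def by simp
    moreover have "\<bar>2 * ?m\<bar> \<le> int N * 2 ^ Suc n"
      using floor_scaled_bound[OF assms, of n] by simp
    ultimately show ?thesis using inc[of "2 * ?m" "Suc n"] by (simp only:)
  qed
qed

text \<open>The factor \<open>1 - \<rho> ^ k\<close> is kept so that the induction on k closes with
  equality in the geometric sum. The extra factor \<rho> of each step is given away to let that sum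
  start at \<open>\<rho> ^ n\<close>.\<close>

lemma dyadic_floor_dist:
  assumes "\<bar>u\<bar> \<le> real N"
  shows "\<bar>f (dyadic_floor (n + k) u) - f (dyadic_floor n u)\<bar> \<le> K * \<rho> ^ n * (1 - \<rho> ^ k) / (1 - \<rho>)"
proof (induction k)
  case 0
  then show ?case by simp
next
  case (Suc k)
  have "\<bar>f (dyadic_floor (n + Suc k) u) - f (dyadic_floor n u)\<bar> \<le>
      K * \<rho> ^ Suc (n + k) + K * \<rho> ^ n * (1 - \<rho> ^ k) / (1 - \<rho>)"
    using Suc dyadic_floor_step[OF assms, of "n + k"] by simp
  also have "\<dots> \<le> K * \<rho> ^ (n + k) + K * \<rho> ^ n * (1 - \<rho> ^ k) / (1 - \<rho>)"
    using K \<rho> by (intro add_right_mono mult_left_mono power_decreasing) auto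
  also have "\<dots> = K * \<rho> ^ n * (1 - \<rho> ^ Suc k) / (1 - \<rho>)"
  proof -
    have "1 - \<rho> \<noteq> 0" using \<rho>(2) by linarith
    then show ?thesis by (simp add: divide_simps power_add) (simp add: algebra_simps)
  qed
  finally show ?case .
qed

lemma dyadic_floor_dist':
  assumes "\<bar>u\<bar> \<le> real N"
  shows "\<bar>f (dyadic_floor (n + k) u) - f (dyadic_floor n u)\<bar> \<le> K / (1 - \<rho>) * \<rho> ^ n"
proof -
  have "K * \<rho> ^ n * (1 - \<rho> ^ k) / (1 - \<rho>) \<le> K * \<rho> ^ n * 1 / (1 - \<rho>)"
    using K \<rho> by (intro divide_right_mono mult_left_mono) auto
  then show ?thesis using dyadic_floor_dist[OF assms, of n k] by simp
qed

text \<open>The regularized path: it sees f at dyadic points only, where f is controlled. The limit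
  is shown to exist for u between -N and N, and its value depends on neither K nor N.\<close>

definition L :: "real \<Rightarrow> real" where "L u = lim (\<lambda>n. f (dyadic_floor n u))"

lemma L_tendsto:
  assumes "\<bar>u\<bar> \<le> real N"
  shows "(\<lambda>n. f (dyadic_floor n u)) \<longlonglongrightarrow> L u"
proof -
  have "summable (\<lambda>n. f (dyadic_floor (Suc n) u) - f (dyadic_floor n u))"
  proof (rule summable_comparison_test')
    show "summable (\<lambda>n. K * \<rho> ^ Suc n)"
      using \<rho> by (intro summable_mult) (simp add: summable_mult summable_geometric)
    show "norm (f (dyadic_floor (Suc n) u) - f (dyadic_floor n u)) \<le> K * \<rho> ^ Suc n" for n
      using dyadic_floor_step[OF assms, of n] by simp
  qed
  from summable_LIMSEQ[OF this]
  have "convergent (\<lambda>n. f (dyadic_floor n u) - f (dyadic_floor 0 u))"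
    unfolding sum_lessThan_telescope[of "\<lambda>n. f (dyadic_floor n u)"] by (auto simp: convergent_def)
  then have "convergent (\<lambda>n. f (dyadic_floor n u))"
    by (simp add: convergent_diff_const_right_iff)
  then show ?thesis by (simp add: L_def convergent_LIMSEQ_iff)
qed

lemma L_dist:
  assumes "\<bar>u\<bar> \<le> real N"
  shows "\<bar>L u - f (dyadic_floor n u)\<bar> \<le> K / (1 - \<rho>) * \<rho> ^ n"
proof (rule LIMSEQ_le_const2)
  show "(\<lambda>k. \<bar>f (dyadic_floor (k + n) u) - f (dyadic_floor n u)\<bar>) \<longlonglongrightarrow> \<bar>L u - f (dyadic_floor n u)\<bar>"
    by (intro tendsto_intros LIMSEQ_ignore_initial_segment L_tendsto assms)
  show "\<exists>k0. \<forall>k\<ge>k0. \<bar>f (dyadic_floor (k + n) u) - f (dyadic_floor n u)\<bar> \<le> K / (1 - \<rho>) * \<rho> ^ n"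
    using dyadic_floor_dist'[OF assms, of n] by (auto simp: add.commute)
qed

lemma L_holder_close:
  assumes "\<bar>u\<bar> \<le> real N" "\<bar>v\<bar> \<le> real N" "u < v" "v - u \<le> 1"
  shows "\<bar>L u - L v\<bar> \<le> (2 * K / (1 - \<rho>) + K) * 2 powr \<alpha> * (v - u) powr \<alpha>"
proof -
  \<comment> \<open>The level whose mesh matches the distance: v - u lies between half a mesh and a
    full mesh. The full mesh makes the dyadic floors of u and v equal or adjacent, the half mesh
    turns \<open>\<rho> ^ n\<close> into a power of v - u.\<close>
  define n where "n = nat \<lfloor>- log 2 (v - u)\<rfloor>"
  have "0 \<le> - log 2 (v - u)" using assms by (simp add: log_le_zero_cancel_iff)
  then have n: "real n \<le> - log 2 (v - u)" "- log 2 (v - u) < real (Suc n)"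
    unfolding n_def by linarith+
  have n1: "2 ^ n * (v - u) \<le> 1"
  proof -
    have "log 2 (v - u) \<le> - real n" using n by linarith
    then have "v - u \<le> 2 powr (- real n)" using assms by (simp add: log_le_iff)
    then show ?thesis by (simp add: powr_minus powr_realpow field_simps)
  qed
  have n2: "1 / 2 ^ n \<le> 2 * (v - u)"
  proof -
    have "- real (Suc n) < log 2 (v - u)" using n by linarith
    then have "2 powr (- real (Suc n)) < v - u" using assms by (simp add: less_log_iff)
    then show ?thesis
      by (simp add: powr_minus powr_realpow field_simps del: of_nat_Suc)
  qed
  have \<rho>n: "\<rho> ^ n \<le> 2 powr \<alpha> * (v - u) powr \<alpha>"
  proof -
    have "\<rho> ^ n = (1 / 2 ^ n) powr \<alpha>"
      by (simp add: powr_realpow[symmetric] powr_powr powr_minus_divide[symmetric] mult.commute)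
    also have "\<dots> \<le> (2 * (v - u)) powr \<alpha>"
      using n2 \<alpha> by (intro powr_mono2) auto
    also have "\<dots> = 2 powr \<alpha> * (v - u) powr \<alpha>"
      using assms by (subst powr_mult) auto
    finally show ?thesis .
  qed
  have mid: "\<bar>f (dyadic_floor n v) - f (dyadic_floor n u)\<bar> \<le> K * \<rho> ^ n"
  proof -
    let ?m = "\<lfloor>2 ^ n * u\<rfloor>"
    have "2 ^ n * u \<le> 2 ^ n * v" "2 ^ n * v \<le> 2 ^ n * u + 1"
      using assms n1 by (auto simp: algebra_simps)
    then have "\<lfloor>2 ^ n * v\<rfloor> = ?m \<or> \<lfloor>2 ^ n * v\<rfloor> = ?m + 1" by linarith
    then show ?thesis
      using inc[OF floor_scaled_bound[OF assms(1)], of n] K \<rho> by (auto simp: dyadic_floor_def)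
  qed
  have "\<bar>L u - L v\<bar> \<le> (2 * K / (1 - \<rho>) + K) * \<rho> ^ n"
  proof -
    have "(2 * K / (1 - \<rho>) + K) * \<rho> ^ n = 2 * (K / (1 - \<rho>) * \<rho> ^ n) + K * \<rho> ^ n"
      by (simp add: distrib_right)
    then show ?thesis
      using mid L_dist[OF assms(1), of n] L_dist[OF assms(2), of n] by linarith
  qed
  also have "\<dots> \<le> (2 * K / (1 - \<rho>) + K) * (2 powr \<alpha> * (v - u) powr \<alpha>)"
    using \<rho>n K \<rho> by (intro mult_left_mono) auto
  finally show ?thesis by (simp add: mult.assoc)
qed

lemma L_holder:
  "\<exists>C. \<forall>u v. \<bar>u\<bar> \<le> real N \<longrightarrow> \<bar>v\<bar> \<le> real N \<longrightarrow> \<bar>L u - L v\<bar> \<le> C * \<bar>u - v\<bar> powr \<alpha>"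
proof -
  \<comment> \<open>Points more than 1 apart are handled by boundedness of L: its value is within K
    / (1 - \<rho>) of f at an integer, and B bounds f at all the integers in question.\<close>
  define B where "B = (\<Sum>k\<in>{- int N..int N}. \<bar>f (real_of_int k)\<bar>)"
  define C1 where "C1 = (2 * K / (1 - \<rho>) + K) * 2 powr \<alpha>"
  define C2 where "C2 = 2 * (K / (1 - \<rho>) + B)"
  have "0 \<le> B" unfolding B_def by (intro sum_nonneg) auto
  have C: "0 \<le> C1" "0 \<le> C2" using K \<rho> \<open>0 \<le> B\<close> by (auto simp: C1_def C2_def)
  have bound: "\<bar>L u\<bar> \<le> K / (1 - \<rho>) + B" if "\<bar>u\<bar> \<le> real N" for u
  proof -
    have "\<lfloor>u\<rfloor> \<in> {- int N..int N}" using floor_scaled_bound[OF that, of 0] by auto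
    then have "\<bar>f (real_of_int \<lfloor>u\<rfloor>)\<bar> \<le> B"
      unfolding B_def by (intro member_le_sum) auto
    moreover have "\<bar>L u - f (real_of_int \<lfloor>u\<rfloor>)\<bar> \<le> K / (1 - \<rho>)"
      using L_dist[OF that, of 0] by (simp add: dyadic_floor_def)
    ultimately show ?thesis by linarith
  qed
  have le: "\<bar>L u - L v\<bar> \<le> (C1 + C2) * \<bar>u - v\<bar> powr \<alpha>" if "\<bar>u\<bar> \<le> real N" "\<bar>v\<bar> \<le> real N" "u < v" for u v
  proof (cases "v - u \<le> 1")
    case True
    have "\<bar>L u - L v\<bar> \<le> C1 * \<bar>u - v\<bar> powr \<alpha>"
      using L_holder_close[OF that True] that by (simp add: C1_def abs_minus_commute)
    also have "\<dots> \<le> (C1 + C2) * \<bar>u - v\<bar> powr \<alpha>" using C by (intro mult_right_mono) auto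
    finally show ?thesis .
  next
    case False
    have "\<bar>L u - L v\<bar> \<le> C2 * 1"
    proof -
      have "\<bar>L u - L v\<bar> \<le> \<bar>L u\<bar> + \<bar>L v\<bar>" by (rule abs_triangle_ineq4)
      also have "\<dots> \<le> (K / (1 - \<rho>) + B) + (K / (1 - \<rho>) + B)" by (intro add_mono bound that)
      finally show ?thesis by (simp add: C2_def)
    qed
    also have "\<dots> \<le> (C1 + C2) * \<bar>u - v\<bar> powr \<alpha>"
      using C False that \<alpha> by (intro mult_mono ge_one_powr_ge_zero) auto
    finally show ?thesis .
  qed
  have "\<bar>L u - L v\<bar> \<le> (C1 + C2) * \<bar>u - v\<bar> powr \<alpha>" if "\<bar>u\<bar> \<le> real N" "\<bar>v\<bar> \<le> real N" for u v
    using le[of u v] le[of v u] that by (cases u v rule: linorder_cases) (auto simp: abs_minus_commute)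
  then show ?thesis by blast
qed

end

lemma locally_holder_dyadic_limit:
  assumes "0 < \<alpha>"
    and inc: "\<And>N. \<exists>K. \<forall>n k. \<bar>k :: int\<bar> \<le> int N * 2 ^ n \<longrightarrow>
      \<bar>f (real_of_int (k + 1) / 2 ^ n) - f (real_of_int k / 2 ^ n)\<bar> \<le> real K * (2 powr - \<alpha>) ^ n"
  shows "locally_holder (\<lambda>u. lim (\<lambda>n. f (dyadic_floor n u))) \<alpha>"
  unfolding locally_holder_def
proof (intro allI)
  fix a b :: real
  obtain N :: nat where N: "max \<bar>a\<bar> \<bar>b\<bar> \<le> real N" using real_arch_simple by blast
  obtain K :: nat where K: "\<forall>n k. \<bar>k :: int\<bar> \<le> int N * 2 ^ n \<longrightarrow>
      \<bar>f (real_of_int (k + 1) / 2 ^ n) - f (real_of_int k / 2 ^ n)\<bar> \<le> real K * (2 powr - \<alpha>) ^ n"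
    using inc[of N] by blast
  interpret dyadic_increments f \<alpha> "real K" N
    using K \<open>0 < \<alpha>\<close> by unfold_locales auto
  have "\<bar>u\<bar> \<le> real N" if "u \<in> {a..b}" for u using that N by auto
  then show "\<exists>C. \<forall>u\<in>{a..b}. \<forall>v\<in>{a..b}. \<bar>lim (\<lambda>n. f (dyadic_floor n u)) - lim (\<lambda>n. f (dyadic_floor n v))\<bar>
      \<le> C * \<bar>u - v\<bar> powr \<alpha>"
    using L_holder unfolding L_def by meson
qed


section \<open>The probabilistic half of the Kolmogorov-Chentsov argument\<close>

context prob_space
begin

text \<open>Instead of Markov's inequality and Borel-Cantelli, all scaled increments are raised to
  the power 2m and summed. The sum has finite expectation, so it is almost surely finite and bounds
  each of its terms.\<close>

lemma AE_dyadic_increments: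
  fixes Z :: "real \<Rightarrow> 'a \<Rightarrow> real"
  assumes [measurable]: "\<And>u. random_variable borel (Z u)"
    and moments: "\<And>m. 1 \<le> m \<Longrightarrow> \<exists>C. \<forall>u v. \<bar>u - v\<bar> \<le> 1 \<longrightarrow>
      integrable M (\<lambda>\<omega>. (Z u \<omega> - Z v \<omega>) ^ (2 * m)) \<and>
      expectation (\<lambda>\<omega>. (Z u \<omega> - Z v \<omega>) ^ (2 * m)) \<le> C * \<bar>u - v\<bar> ^ m"
    and \<alpha>: "\<alpha> < 1 / 2"
  shows "AE \<omega> in M. \<exists>K. \<forall>n k. \<bar>k :: int\<bar> \<le> int N * 2 ^ n \<longrightarrow>
      \<bar>Z (real_of_int (k + 1) / 2 ^ n) \<omega> - Z (real_of_int k / 2 ^ n) \<omega>\<bar> \<le> real K * (2 powr - \<alpha>) ^ n"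
proof -
  \<comment> \<open>Level n has about \<open>2 ^ n\<close> increments, each with scaled moment of
    order 2 to the power -n m (1 - 2 \<alpha>). This choice of m beats their number: the ratio x
    below is 2 to the power 1 - m (1 - 2 \<alpha>), which is less than 1.\<close>
  obtain m :: nat where m: "1 < real m * (1 - 2 * \<alpha>)"
    using ex_less_of_nat_mult[of "1 - 2 * \<alpha>" 1] \<alpha> by auto
  then have "1 \<le> m" by (cases m) auto
  obtain C where C: "\<And>u v. \<bar>u - v\<bar> \<le> 1 \<Longrightarrow>
      integrable M (\<lambda>\<omega>. (Z u \<omega> - Z v \<omega>) ^ (2 * m)) \<and>
      expectation (\<lambda>\<omega>. (Z u \<omega> - Z v \<omega>) ^ (2 * m)) \<le> C * \<bar>u - v\<bar> ^ m"
    using moments[OF \<open>1 \<le> m\<close>] by blast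
  define r where "r = (2::real) powr \<alpha>"
  define x where "x = 2 * r ^ (2 * m) / 2 ^ m"
  define D where "D n k \<omega> = Z (real_of_int (k + 1) / 2 ^ n) \<omega> - Z (real_of_int k / 2 ^ n) \<omega>" for n :: nat and k \<omega>
  define A where "A n = {- (int N * 2 ^ n)..int N * 2 ^ n}" for n :: nat
  define S where "S \<omega> = (\<Sum>n. \<Sum>k\<in>A n. ennreal ((r ^ n * D n k \<omega>) ^ (2 * m)))" for \<omega>
  have [measurable]: "D n k \<in> borel_measurable M" for n k
    unfolding D_def by measurable
  have r: "0 < r" by (simp add: r_def)
  have "0 \<le> C"
  proof -
    have "0 \<le> expectation (\<lambda>\<omega>. (Z 1 \<omega> - Z 0 \<omega>) ^ (2 * m))" by (rule Bochner_Integration.integral_nonneg) simp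
    also have "\<dots> \<le> C" using C[of 1 0] by simp
    finally show ?thesis .
  qed
  have x: "0 \<le> x" "x < 1"
  proof -
    have "x = 2 powr (1 - real m * (1 - 2 * \<alpha>))"
      unfolding x_def r_def
      by (simp add: powr_realpow[symmetric] powr_powr powr_diff powr_add algebra_simps
          del: powr_realpow')
    then show "x < 1" using m powr_less_one[of 2 "1 - real m * (1 - 2 * \<alpha>)"] by simp
  qed (use r in \<open>simp add: x_def\<close>)
  have term_le: "(\<integral>\<^sup>+\<omega>. ennreal ((r ^ n * D n k \<omega>) ^ (2 * m)) \<partial>M) \<le> ennreal (C * (r ^ (2 * m) / 2 ^ m) ^ n)" for n k
  proof -
    have d: "\<bar>real_of_int (k + 1) / 2 ^ n - real_of_int k / 2 ^ n\<bar> = 1 / 2 ^ n"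
      by (simp add: diff_divide_distrib[symmetric])
    then have D: "integrable M (\<lambda>\<omega>. D n k \<omega> ^ (2 * m))" "expectation (\<lambda>\<omega>. D n k \<omega> ^ (2 * m)) \<le> C * (1 / 2 ^ n) ^ m"
      using C[of "real_of_int (k + 1) / 2 ^ n" "real_of_int k / 2 ^ n"] unfolding D_def d by auto
    have "(\<integral>\<^sup>+\<omega>. ennreal ((r ^ n * D n k \<omega>) ^ (2 * m)) \<partial>M) = ennreal (expectation (\<lambda>\<omega>. (r ^ n * D n k \<omega>) ^ (2 * m)))"
      using D(1) by (intro nn_integral_eq_integral) (auto simp: power_mult_distrib)
    also have "expectation (\<lambda>\<omega>. (r ^ n * D n k \<omega>) ^ (2 * m)) = (r ^ n) ^ (2 * m) * expectation (\<lambda>\<omega>. D n k \<omega> ^ (2 * m))"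
      by (simp add: power_mult_distrib)
    also have "ennreal \<dots> \<le> ennreal ((r ^ n) ^ (2 * m) * (C * (1 / 2 ^ n) ^ m))"
      using D(2) r by (intro ennreal_leI mult_left_mono) auto
    also have "(r ^ n) ^ (2 * m) * (C * (1 / 2 ^ n) ^ m) = C * (r ^ (2 * m) / 2 ^ m) ^ n"
      by (simp add: power_divide mult_ac flip: power_mult)
    finally show ?thesis .
  qed
  have "(\<integral>\<^sup>+\<omega>. S \<omega> \<partial>M) = (\<Sum>n. \<Sum>k\<in>A n. \<integral>\<^sup>+\<omega>. ennreal ((r ^ n * D n k \<omega>) ^ (2 * m)) \<partial>M)"
    unfolding S_def by (simp add: nn_integral_suminf nn_integral_sum del: sum_ennreal)
  also have "\<dots> \<le> (\<Sum>n. ennreal ((2 * real N + 1) * C * x ^ n))"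
  proof (intro suminf_le summableI)
    fix n
    have "(\<Sum>k\<in>A n. \<integral>\<^sup>+\<omega>. ennreal ((r ^ n * D n k \<omega>) ^ (2 * m)) \<partial>M) \<le>
      (\<Sum>k\<in>A n. ennreal (C * (r ^ (2 * m) / 2 ^ m) ^ n))"
      by (intro sum_mono term_le)
    also have "\<dots> = ennreal (real (card (A n)) * (C * (r ^ (2 * m) / 2 ^ m) ^ n))"
      using \<open>0 \<le> C\<close> r by (simp add: ennreal_mult' ennreal_of_nat_eq_real_of_nat)
    also have "\<dots> \<le> ennreal ((2 * real N + 1) * 2 ^ n * (C * (r ^ (2 * m) / 2 ^ m) ^ n))"
    proof (intro ennreal_leI mult_right_mono)
      have "real (card (A n)) = 2 * real N * 2 ^ n + 1"
        by (simp add: A_def)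
      also have "\<dots> \<le> (2 * real N + 1) * 2 ^ n"
        by (simp add: algebra_simps)
      finally show "real (card (A n)) \<le> (2 * real N + 1) * 2 ^ n" .
    qed (use \<open>0 \<le> C\<close> r in auto)
    also have "(2 * real N + 1) * 2 ^ n * (C * (r ^ (2 * m) / 2 ^ m) ^ n) = (2 * real N + 1) * C * x ^ n"
      by (simp add: x_def power_divide power_mult_distrib)
    finally show "(\<Sum>k\<in>A n. \<integral>\<^sup>+\<omega>. ennreal ((r ^ n * D n k \<omega>) ^ (2 * m)) \<partial>M) \<le> ennreal ((2 * real N + 1) * C * x ^ n)" .
  qed
  also have "\<dots> < \<infinity>"
    unfolding less_top[symmetric] infinity_ennreal_def using x \<open>0 \<le> C\<close>
    by (intro ennreal_suminf_neq_top summable_mult summable_geometric) auto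
  finally have "(\<integral>\<^sup>+\<omega>. S \<omega> \<partial>M) \<noteq> \<infinity>" by simp
  then have "AE \<omega> in M. S \<omega> \<noteq> \<infinity>"
    by (intro nn_integral_PInf_AE) (auto simp: S_def)
  then show ?thesis
  proof eventually_elim
    case (elim \<omega>)
    \<comment> \<open>With K at least 1 one has \<open>real K \<le> real K ^ (2 * m)\<close>, so the
      root of order 2m can be taken without changing the constant.\<close>
    obtain K :: nat where K: "S \<omega> \<le> ennreal (real K)" "1 \<le> K"
    proof -
      obtain s where "S \<omega> = ennreal s" "0 \<le> s" using elim by (cases "S \<omega>") auto
      moreover obtain K :: nat where "max 1 s \<le> real K" using real_arch_simple by blast
      ultimately show ?thesis using that[of K] by (simp add: ennreal_leI)
    qed
    have "\<bar>D n k \<omega>\<bar> \<le> real K * (2 powr - \<alpha>) ^ n" if "\<bar>k\<bar> \<le> int N * 2 ^ n" for n k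
    proof -
      have "k \<in> A n" using that by (auto simp: A_def)
      then have "ennreal ((r ^ n * D n k \<omega>) ^ (2 * m)) \<le> (\<Sum>k\<in>A n. ennreal ((r ^ n * D n k \<omega>) ^ (2 * m)))"
        by (intro member_le_sum) (auto simp: A_def)
      also have "\<dots> \<le> S \<omega>"
        unfolding S_def
        using sum_le_suminf[of "\<lambda>n. \<Sum>k\<in>A n. ennreal ((r ^ n * D n k \<omega>) ^ (2 * m))" "{n}"] by simp
      also note K(1)
      finally have "(r ^ n * D n k \<omega>) ^ (2 * m) \<le> real K" by simp
      then have "\<bar>r ^ n * D n k \<omega>\<bar> ^ (2 * m) \<le> real K"
        by (simp add: power_mult)
      also have "\<dots> \<le> real K ^ (2 * m)"
        using K(2) \<open>1 \<le> m\<close> by (intro self_le_power) auto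
      finally have "\<bar>r ^ n * D n k \<omega>\<bar> \<le> real K"
        using \<open>1 \<le> m\<close> by (subst (asm) power_mono_iff) auto
      then have "r ^ n * \<bar>D n k \<omega>\<bar> \<le> real K"
        using r by (simp add: abs_mult)
      then have "\<bar>D n k \<omega>\<bar> \<le> real K * (1 / r) ^ n"
        using r by (simp add: power_divide field_simps)
      moreover have "2 powr - \<alpha> = 1 / r" by (simp add: r_def powr_minus_divide)
      ultimately show ?thesis by simp
    qed
    then show ?case unfolding D_def by blast
  qed
qed

text \<open>For a fixed u the second moments of the errors are at most C times the mesh, hence
  summable over n. This makes the dyadic limit a version of Z rather than some other continuous
  process.\<close>

lemma AE_dyadic_floor_tendsto:
  fixes Z :: "real \<Rightarrow> 'a \<Rightarrow> real"
  assumes [measurable]: "\<And>u. random_variable borel (Z u)"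
    and C: "\<And>u v. \<bar>u - v\<bar> \<le> 1 \<Longrightarrow> integrable M (\<lambda>\<omega>. (Z u \<omega> - Z v \<omega>)\<^sup>2) \<and>
      expectation (\<lambda>\<omega>. (Z u \<omega> - Z v \<omega>)\<^sup>2) \<le> C * \<bar>u - v\<bar>"
  shows "AE \<omega> in M. (\<lambda>n. Z (dyadic_floor n u) \<omega>) \<longlonglongrightarrow> Z u \<omega>"
proof -
  have "0 \<le> C"
  proof -
    have "0 \<le> expectation (\<lambda>\<omega>. (Z 1 \<omega> - Z 0 \<omega>)\<^sup>2)" by (rule Bochner_Integration.integral_nonneg) simp
    also have "\<dots> \<le> C" using C[of 1 0] by simp
    finally show ?thesis .
  qed
  have "(\<integral>\<^sup>+\<omega>. (\<Sum>n. ennreal ((Z (dyadic_floor n u) \<omega> - Z u \<omega>)\<^sup>2)) \<partial>M) =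
      (\<Sum>n. \<integral>\<^sup>+\<omega>. ennreal ((Z (dyadic_floor n u) \<omega> - Z u \<omega>)\<^sup>2) \<partial>M)"
    by (rule nn_integral_suminf) simp
  also have "\<dots> \<le> (\<Sum>n. ennreal (C * (1 / 2) ^ n))"
  proof (intro suminf_le summableI)
    fix n
    have d: "\<bar>dyadic_floor n u - u\<bar> \<le> 1 / 2 ^ n"
      using dyadic_floor_bounds[where n=n and u=u] by simp
    also have "\<dots> \<le> 1" by simp
    finally have le1: "\<bar>dyadic_floor n u - u\<bar> \<le> 1" .
    have "(\<integral>\<^sup>+\<omega>. ennreal ((Z (dyadic_floor n u) \<omega> - Z u \<omega>)\<^sup>2) \<partial>M) =
      ennreal (expectation (\<lambda>\<omega>. (Z (dyadic_floor n u) \<omega> - Z u \<omega>)\<^sup>2))"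
      using C[OF le1] by (intro nn_integral_eq_integral) auto
    also have "\<dots> \<le> ennreal (C * \<bar>dyadic_floor n u - u\<bar>)"
      using C[OF le1] by (intro ennreal_leI) auto
    also have "\<dots> \<le> ennreal (C * (1 / 2) ^ n)"
      using d \<open>0 \<le> C\<close> by (intro ennreal_leI mult_left_mono) (auto simp: power_divide)
    finally show "(\<integral>\<^sup>+\<omega>. ennreal ((Z (dyadic_floor n u) \<omega> - Z u \<omega>)\<^sup>2) \<partial>M) \<le> ennreal (C * (1 / 2) ^ n)" .
  qed
  also have "\<dots> < \<infinity>"
    unfolding less_top[symmetric] infinity_ennreal_def using \<open>0 \<le> C\<close>
    by (intro ennreal_suminf_neq_top summable_mult summable_geometric) auto
  finally have "(\<integral>\<^sup>+\<omega>. (\<Sum>n. ennreal ((Z (dyadic_floor n u) \<omega> - Z u \<omega>)\<^sup>2)) \<partial>M) \<noteq> \<infinity>" by simp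
  then have "AE \<omega> in M. (\<Sum>n. ennreal ((Z (dyadic_floor n u) \<omega> - Z u \<omega>)\<^sup>2)) \<noteq> \<infinity>"
    by (intro nn_integral_PInf_AE) auto
  then show ?thesis
  proof eventually_elim
    case (elim \<omega>)
    then have "summable (\<lambda>n. (Z (dyadic_floor n u) \<omega> - Z u \<omega>)\<^sup>2)"
      by (intro summable_suminf_not_top) auto
    from tendsto_real_sqrt[OF summable_LIMSEQ_zero[OF this]]
    have "(\<lambda>n. \<bar>Z (dyadic_floor n u) \<omega> - Z u \<omega>\<bar>) \<longlonglongrightarrow> 0" by simp
    then show ?case
      by (simp add: tendsto_rabs_zero_iff LIM_zero_iff)
  qed
qed

theorem holder_version:
  fixes Z :: "real \<Rightarrow> 'a \<Rightarrow> real"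
  assumes [measurable]: "\<And>u. random_variable borel (Z u)"
    and moments: "\<And>m. 1 \<le> m \<Longrightarrow> \<exists>C. \<forall>u v. \<bar>u - v\<bar> \<le> 1 \<longrightarrow>
      integrable M (\<lambda>\<omega>. (Z u \<omega> - Z v \<omega>) ^ (2 * m)) \<and>
      expectation (\<lambda>\<omega>. (Z u \<omega> - Z v \<omega>) ^ (2 * m)) \<le> C * \<bar>u - v\<bar> ^ m"
  shows "\<exists>Z'. (\<forall>u. random_variable borel (Z' u) \<and> (AE \<omega> in M. Z' u \<omega> = Z u \<omega>)) \<and>
    (\<forall>\<omega>\<in>space M. \<forall>\<alpha>. 0 < \<alpha> \<and> \<alpha> < 1 / 2 \<longrightarrow> locally_holder (\<lambda>u. Z' u \<omega>) \<alpha>)"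
proof -
  \<comment> \<open>Countably many exponents approaching 1/2 let one null set serve every \<alpha>
    below 1/2.\<close>
  define \<beta> where "\<beta> j = 1 / 2 - 1 / real (j + 3)" for j :: nat
  \<comment> \<open>All quantifiers, including that over the natural number K, range over countable
    sets, so this event is measurable. Off it the path is replaced by 0, which keeps the Hoelder
    property valid everywhere.\<close>
  define good where "good \<omega> \<longleftrightarrow> (\<forall>j N. \<exists>K. \<forall>n k. \<bar>k :: int\<bar> \<le> int N * 2 ^ n \<longrightarrow>
      \<bar>Z (real_of_int (k + 1) / 2 ^ n) \<omega> - Z (real_of_int k / 2 ^ n) \<omega>\<bar> \<le> real K * (2 powr - \<beta> j) ^ n)" for \<omega>
  define Z' where "Z' u \<omega> = (if good \<omega> then lim (\<lambda>n. Z (dyadic_floor n u) \<omega>) else 0)" for u \<omega>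
  have [measurable]: "Measurable.pred M good"
    unfolding good_def by measurable
  have "AE \<omega> in M. \<exists>K. \<forall>n k. \<bar>k :: int\<bar> \<le> int N * 2 ^ n \<longrightarrow>
      \<bar>Z (real_of_int (k + 1) / 2 ^ n) \<omega> - Z (real_of_int k / 2 ^ n) \<omega>\<bar> \<le> real K * (2 powr - \<beta> j) ^ n" for j N
    by (rule AE_dyadic_increments) (use moments in \<open>auto simp: \<beta>_def\<close>)
  then have AE_good: "AE \<omega> in M. good \<omega>"
    unfolding good_def by (simp add: AE_all_countable)
  have "AE \<omega> in M. Z' u \<omega> = Z u \<omega>" for u
  proof -
    obtain C where "\<And>u v. \<bar>u - v\<bar> \<le> 1 \<Longrightarrow> integrable M (\<lambda>\<omega>. (Z u \<omega> - Z v \<omega>)\<^sup>2) \<and>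
      expectation (\<lambda>\<omega>. (Z u \<omega> - Z v \<omega>)\<^sup>2) \<le> C * \<bar>u - v\<bar>"
      using moments[of 1] by (auto simp: numeral_2_eq_2)
    then have "AE \<omega> in M. (\<lambda>n. Z (dyadic_floor n u) \<omega>) \<longlonglongrightarrow> Z u \<omega>"
      by (intro AE_dyadic_floor_tendsto) auto
    then show ?thesis using AE_good
      by eventually_elim (auto simp: Z'_def intro: limI)
  qed
  moreover have "random_variable borel (Z' u)" for u
    unfolding Z'_def by measurable
  moreover have "locally_holder (\<lambda>u. Z' u \<omega>) \<alpha>" if \<alpha>: "0 < \<alpha>" "\<alpha> < 1 / 2" for \<omega> \<alpha>
  proof (cases "good \<omega>")
    case True
    obtain j :: nat where "1 / (1 / 2 - \<alpha>) \<le> real j" using real_arch_simple by blast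
    then have j: "\<alpha> \<le> \<beta> j" using \<alpha> by (simp add: \<beta>_def field_simps)
    have "locally_holder (\<lambda>u. lim (\<lambda>n. Z (dyadic_floor n u) \<omega>)) \<alpha>"
    proof (rule locally_holder_dyadic_limit[OF \<alpha>(1)])
      fix N :: nat
      obtain K :: nat where K: "\<And>n k. \<bar>k :: int\<bar> \<le> int N * 2 ^ n \<Longrightarrow>
        \<bar>Z (real_of_int (k + 1) / 2 ^ n) \<omega> - Z (real_of_int k / 2 ^ n) \<omega>\<bar> \<le> real K * (2 powr - \<beta> j) ^ n"
        using True unfolding good_def by blast
      have "real K * (2 powr - \<beta> j) ^ n \<le> real K * (2 powr - \<alpha>) ^ n" for n
        using j by (intro mult_left_mono power_mono powr_mono) auto
      with K show "\<exists>K. \<forall>n k. \<bar>k :: int\<bar> \<le> int N * 2 ^ n \<longrightarrow>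
        \<bar>Z (real_of_int (k + 1) / 2 ^ n) \<omega> - Z (real_of_int k / 2 ^ n) \<omega>\<bar> \<le> real K * (2 powr - \<alpha>) ^ n"
        by (meson order_trans)
    qed
    then show ?thesis using True by (simp add: Z'_def)
  next
    case False
    then show ?thesis by (auto simp: Z'_def locally_holder_def intro!: exI[of _ 0])
  qed
  ultimately show ?thesis by blast
qed

end

section \<open>Poisson probabilities under \<open>P_unif\<close>\<close>

text \<open>The event N(s) = k, with a = \<open>exp (- s)\<close> as parameter: removing the first
  factor y from the products merely replaces a by a / y.\<close>

definition poisson_band :: "nat \<Rightarrow> real \<Rightarrow> (nat \<Rightarrow> real) set" where
  "poisson_band k a = {y. (\<Prod>i<k+1. y i) < a \<and> a < (\<Prod>i<k. y i)}"

abbreviation unif01 :: "real measure" where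
  "unif01 \<equiv> uniform_measure lborel {0..1}"

lemma prob_space_unif01: "prob_space unif01"
  by (rule prob_space_uniform_measure) auto

interpretation unif_seq: sequence_space unif01
proof -
  interpret prob_space unif01 by (rule prob_space_unif01)
  show "sequence_space unif01" by unfold_locales
qed

interpretation P_unif: prob_space P_unif
  unfolding P_unif_def by (rule unif_seq.prob_space_axioms)

lemma space_P_unif [simp]: "space P_unif = UNIV"
  unfolding P_unif_def by (simp add: space_PiM)

lemma measurable_P_unif_component [measurable]: "(\<lambda>y. y i) \<in> borel_measurable P_unif"
  using measurable_component_singleton[of i UNIV "\<lambda>_. unif01"]
  unfolding P_unif_def by (simp add: measurable_cong_sets[OF refl, of unif01 borel])

lemma poisson_band_measurable [measurable]: "poisson_band k a \<in> sets P_unif"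
proof -
  have "{y \<in> space P_unif. (\<Prod>i<k+1. y i) < a \<and> a < (\<Prod>i<k. y i)} \<in> sets P_unif"
    by measurable
  then show ?thesis by (simp add: poisson_band_def)
qed

lemma P_unif_prod_le_1: "AE y in P_unif. \<forall>k. (\<Prod>i<k. y i) \<le> 1"
proof -
  have "AE y in P_unif. 0 \<le> y i \<and> y i \<le> 1" for i
    unfolding P_unif_def
    by (rule AE_PiM_component[where P="\<lambda>y. 0 \<le> y \<and> y \<le> 1"])
      (auto intro: prob_space_unif01 AE_uniform_measureI)
  then have "AE y in P_unif. \<forall>i. 0 \<le> y i \<and> y i \<le> 1"
    by (subst AE_all_countable) auto
  then show ?thesis
    by eventually_elim (auto intro!: prod_le_1)
qed

text \<open>The renewal step: an i.i.d. sequence is an independent first coordinate followed by a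
  copy of the whole sequence, so probabilities can be computed by conditioning on the first
  coordinate.\<close>

lemma emeasure_P_unif_iter:
  assumes [measurable]: "A \<in> sets P_unif"
  shows "emeasure P_unif A =
    (\<integral>\<^sup>+y. emeasure P_unif {\<omega>. case_nat y \<omega> \<in> A} * indicator {0..1} y \<partial>lborel)"
proof -
  interpret pair_sigma_finite unif01 unif_seq.S ..
  have A: "A \<in> sets unif_seq.S" using assms by (simp add: P_unif_def)
  have m: "(\<lambda>(s, \<omega>). case_nat s \<omega>) \<in> measurable (unif01 \<Otimes>\<^sub>M unif_seq.S) unif_seq.S"
    by measurable
  have "emeasure P_unif A =
      emeasure (distr (unif01 \<Otimes>\<^sub>M unif_seq.S) unif_seq.S (\<lambda>(s, \<omega>). case_nat s \<omega>)) A"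
    by (simp add: unif_seq.PiM_iter P_unif_def)
  also have "\<dots> = emeasure (unif01 \<Otimes>\<^sub>M unif_seq.S)
      ((\<lambda>(s, \<omega>). case_nat s \<omega>) -` A \<inter> space (unif01 \<Otimes>\<^sub>M unif_seq.S))"
    using A m by (rule emeasure_distr[rotated])
  also have "\<dots> = (\<integral>\<^sup>+y. emeasure unif_seq.S (Pair y -` ((\<lambda>(s, \<omega>). case_nat s \<omega>) -` A
      \<inter> space (unif01 \<Otimes>\<^sub>M unif_seq.S))) \<partial>unif01)"
    by (rule unif_seq.emeasure_pair_measure_alt[OF measurable_sets[OF m A]])
  also have "\<dots> = (\<integral>\<^sup>+y. emeasure P_unif {\<omega>. case_nat y \<omega> \<in> A} \<partial>unif01)"
    by (auto intro!: nn_integral_cong arg_cong2[where f=emeasure]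
        simp: P_unif_def space_pair_measure space_PiM)
  also have "\<dots> = (\<integral>\<^sup>+y. emeasure P_unif {\<omega>. case_nat y \<omega> \<in> A} * indicator {0..1} y \<partial>lborel)"
  proof -
    have "(\<lambda>y. emeasure P_unif {\<omega>. case_nat y \<omega> \<in> A}) \<in> borel_measurable lborel"
    proof -
      have "(\<lambda>y. emeasure unif_seq.S (Pair y -` ((\<lambda>(s, \<omega>). case_nat s \<omega>) -` A
          \<inter> space (unif01 \<Otimes>\<^sub>M unif_seq.S)))) \<in> borel_measurable unif01"
        by (rule unif_seq.measurable_emeasure_Pair[OF measurable_sets[OF m A]])
      also have "(\<lambda>y. emeasure unif_seq.S (Pair y -` ((\<lambda>(s, \<omega>). case_nat s \<omega>) -` A
          \<inter> space (unif01 \<Otimes>\<^sub>M unif_seq.S)))) = (\<lambda>y. emeasure P_unif {\<omega>. case_nat y \<omega> \<in> A})"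
        by (auto intro!: ext arg_cong2[where f=emeasure]
            simp: P_unif_def space_pair_measure space_PiM)
      finally show ?thesis by (simp add: measurable_cong_sets[of unif01 lborel])
    qed
    then show ?thesis
      by (subst nn_integral_uniform_measure) (auto simp: divide_ennreal_def)
  qed
  finally show ?thesis .
qed

lemma case_nat_in_poisson_band_0:
  "case_nat y \<omega> \<in> poisson_band 0 a \<longleftrightarrow> y < a \<and> a < 1"
  by (simp add: poisson_band_def)

lemma case_nat_in_poisson_band_Suc:
  assumes "0 < y"
  shows "case_nat y \<omega> \<in> poisson_band (Suc k) a \<longleftrightarrow> \<omega> \<in> poisson_band k (a / y)"
  using assms
  by (simp add: poisson_band_def prod.lessThan_Suc_shift field_simps del: prod.lessThan_Suc)

text \<open>If the first factor is already at most a, no longer product can exceed a, because the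
  factors are almost surely at most 1.\<close>

lemma AE_not_case_nat_in_poisson_band_Suc:
  assumes "0 \<le> y" "y \<le> a"
  shows "AE \<omega> in P_unif. case_nat y \<omega> \<notin> poisson_band (Suc k) a"
  using P_unif_prod_le_1
proof eventually_elim
  case (elim \<omega>)
  have "y * (\<Prod>i<k. \<omega> i) \<le> y * 1"
    using elim assms by (intro mult_left_mono) auto
  then show ?case using assms
    by (simp add: poisson_band_def prod.lessThan_Suc_shift del: prod.lessThan_Suc)
qed

text \<open>The integral met at every renewal step: averaging over the first factor raises the power
  of the logarithm, and the factorial, by one.\<close>

lemma nn_integral_log_power_over:
  fixes b c d :: real
  assumes "0 \<le> b" "0 < c" "c \<le> d"
  shows "(\<integral>\<^sup>+y. ennreal (b / y * ((ln (y / c)) ^ k / fact k)) * indicator {c..d} y \<partial>lborel) =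
    ennreal (b * (ln (d / c)) ^ Suc k / fact (Suc k))"
proof -
  have fact: "real (Suc k) / fact (Suc k) = 1 / fact k"
    by (simp add: field_simps del: of_nat_Suc)
  have deriv: "((\<lambda>y. b * (ln (y / c)) ^ Suc k / fact (Suc k)) has_real_derivative
      b / y * ((ln (y / c)) ^ k / fact k)) (at y)" if "c \<le> y" for y
  proof -
    have "((\<lambda>y. b * (ln (y / c)) ^ Suc k / fact (Suc k)) has_real_derivative
      b * (ln (y / c)) ^ k * (1 / y) * (real (Suc k) / fact (Suc k))) (at y)"
      using assms that
      by (auto intro!: derivative_eq_intros simp del: power_Suc of_nat_Suc fact_Suc)
    then show ?thesis by (simp only: fact) (simp add: mult_ac)
  qed
  have "(\<integral>\<^sup>+y. ennreal (b / y * ((ln (y / c)) ^ k / fact k)) * indicator {c..d} y \<partial>lborel) =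
    ennreal (b * (ln (d / c)) ^ Suc k / fact (Suc k) - b * (ln (c / c)) ^ Suc k / fact (Suc k))"
    using assms
    by (intro nn_integral_FTC_Icc deriv)
      (auto intro!: mult_nonneg_nonneg divide_nonneg_nonneg)
  then show ?thesis using assms by simp
qed

text \<open>For a = \<open>exp (- s)\<close>, b = \<open>exp (- t)\<close> and s \<le> t this is the
  probability of N(s) = i and N(t) = j, by independent increments: \<open>exp (- t)\<close> times
  the powers of s and t - s over factorials. It vanishes for i > j since N is nondecreasing.\<close>

definition poisson_joint :: "nat \<Rightarrow> nat \<Rightarrow> real \<Rightarrow> real \<Rightarrow> real" where
  "poisson_joint i j a b =
    (if i \<le> j then b * ((- ln a) ^ i / fact i) * ((ln (a / b)) ^ (j - i) / fact (j - i)) else 0)"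

text \<open>The set A is arbitrary so that the same recursion serves a single band and the
  intersection of two bands.\<close>

lemma emeasure_poisson_band_Suc:
  assumes "0 < a" "a < 1" and [measurable]: "A \<in> sets P_unif"
  shows "emeasure P_unif (poisson_band (Suc k) a \<inter> A) =
    (\<integral>\<^sup>+y. emeasure P_unif (poisson_band k (a / y) \<inter> {\<omega>. case_nat y \<omega> \<in> A}) * indicator {a<..1} y \<partial>lborel)"
proof -
  have "emeasure P_unif (poisson_band (Suc k) a \<inter> A) =
    (\<integral>\<^sup>+y. emeasure P_unif {\<omega>. case_nat y \<omega> \<in> poisson_band (Suc k) a \<inter> A} * indicator {0..1} y \<partial>lborel)"
    by (rule emeasure_P_unif_iter) measurable
  also have "\<dots> = (\<integral>\<^sup>+y. emeasure P_unif (poisson_band k (a / y) \<inter> {\<omega>. case_nat y \<omega> \<in> A}) *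
      indicator {a<..1} y \<partial>lborel)"
  proof (intro nn_integral_cong)
    fix y :: real
    consider "y < 0 \<or> 1 < y" | "0 \<le> y" "y \<le> a" | "a < y" "y \<le> 1"
      by linarith
    then show "emeasure P_unif {\<omega>. case_nat y \<omega> \<in> poisson_band (Suc k) a \<inter> A} * indicator {0..1} y
      = emeasure P_unif (poisson_band k (a / y) \<inter> {\<omega>. case_nat y \<omega> \<in> A}) * indicator {a<..1} y"
    proof cases
      case 1
      then show ?thesis using assms by (auto simp: indicator_def)
    next
      case 2
      have "emeasure P_unif {\<omega>. case_nat y \<omega> \<in> poisson_band (Suc k) a \<inter> A} = 0"
      proof -
        have "AE \<omega> in P_unif. case_nat y \<omega> \<notin> poisson_band (Suc k) a \<inter> A"
          using AE_not_case_nat_in_poisson_band_Suc[OF 2, of k] by eventually_elim simp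
        from emeasure_eq_0_AE[OF this] show ?thesis by simp
      qed
      then show ?thesis using 2 by simp
    next
      case 3
      then show ?thesis using assms
        by (auto simp: case_nat_in_poisson_band_Suc indicator_def intro!: arg_cong[where f="emeasure P_unif"])
    qed
  qed
  finally show ?thesis .
qed

lemma emeasure_poisson_band_0:
  assumes "0 < b" "b \<le> a" "a < 1"
  shows "emeasure P_unif (poisson_band 0 a \<inter> poisson_band 0 b) = ennreal b"
proof -
  have "emeasure P_unif (poisson_band 0 a \<inter> poisson_band 0 b) =
    (\<integral>\<^sup>+y. emeasure P_unif {\<omega>. case_nat y \<omega> \<in> poisson_band 0 a \<inter> poisson_band 0 b} *
      indicator {0..1} y \<partial>lborel)"
    by (rule emeasure_P_unif_iter) measurable
  also have "\<dots> = (\<integral>\<^sup>+y. indicator {0..<b} y \<partial>lborel)"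
    using assms P_unif.emeasure_space_1
    by (auto intro!: nn_integral_cong simp: case_nat_in_poisson_band_0 indicator_def)
  also have "\<dots> = ennreal b" using assms by simp
  finally show ?thesis .
qed

lemma emeasure_poisson_band:
  assumes "0 < a" "a < 1"
  shows "emeasure P_unif (poisson_band k a) = ennreal (a * ((- ln a) ^ k / fact k))"
  using assms
proof (induction k arbitrary: a)
  case 0
  then show ?case using emeasure_poisson_band_0[of a a] by simp
next
  case (Suc k)
  have "emeasure P_unif (poisson_band (Suc k) a) =
    (\<integral>\<^sup>+y. emeasure P_unif (poisson_band k (a / y)) * indicator {a<..1} y \<partial>lborel)"
    using emeasure_poisson_band_Suc[of a UNIV k] Suc.prems sets.top[of P_unif] by simp
  also have "\<dots> = (\<integral>\<^sup>+y. ennreal (a / y * ((ln (y / a)) ^ k / fact k)) * indicator {a..1} y \<partial>lborel)"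
  proof (intro nn_integral_cong_AE)
    have "AE y in lborel. y \<noteq> a"
      by (rule AE_lborel_singleton)
    then show "AE y in lborel. emeasure P_unif (poisson_band k (a / y)) * indicator {a<..1} y =
      ennreal (a / y * ((ln (y / a)) ^ k / fact k)) * indicator {a..1} y"
    proof eventually_elim
      case (elim y)
      show ?case
      proof (cases "a < y \<and> y \<le> 1")
        case True
        then have "- ln (a / y) = ln (y / a)" using Suc.prems by (simp add: ln_div)
        then show ?thesis using True Suc.prems Suc.IH[of "a / y"] by simp
      qed (use elim in \<open>auto simp: indicator_def\<close>)
    qed
  qed
  also have "\<dots> = ennreal (a * (ln (1 / a)) ^ Suc k / fact (Suc k))"
    using Suc.prems by (intro nn_integral_log_power_over) auto
  finally show ?case using Suc.prems by (simp add: ln_div del: power_Suc fact_Suc)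
qed

text \<open>Conditioning on the first factor y > a lowers both counts by one and turns the levels
  into a / y and b / y, whose quotient is unchanged; hence the induction on i with everything else
  general. For i = 0 the first factor lies below a and only one band remains.\<close>

lemma emeasure_poisson_joint:
  assumes "0 < b" "b \<le> a" "a < 1"
  shows "emeasure P_unif (poisson_band i a \<inter> poisson_band j b) = ennreal (poisson_joint i j a b)"
  using assms
proof (induction i arbitrary: j a b)
  case 0
  show ?case
  proof (cases j)
    case 0
    then show ?thesis using emeasure_poisson_band_0 "0.prems" by (simp add: poisson_joint_def)
  next
    case [simp]: (Suc k)
    have "emeasure P_unif (poisson_band 0 a \<inter> poisson_band (Suc k) b) =
       (\<integral>\<^sup>+y. emeasure P_unif (poisson_band k (b / y) \<inter> {\<omega>. case_nat y \<omega> \<in> poisson_band 0 a}) *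
        indicator {b<..1} y \<partial>lborel)"
      using "0.prems" by (subst Int_commute, intro emeasure_poisson_band_Suc) auto
    also have "\<dots> = (\<integral>\<^sup>+y. ennreal (b / y * ((ln (y / b)) ^ k / fact k)) * indicator {b..a} y \<partial>lborel)"
    proof (intro nn_integral_cong_AE)
      have "AE y in lborel. y \<noteq> a" "AE y in lborel. y \<noteq> b"
        by (rule AE_lborel_singleton)+
      then show "AE y in lborel. emeasure P_unif (poisson_band k (b / y) \<inter> {\<omega>. case_nat y \<omega> \<in> poisson_band 0 a}) *
        indicator {b<..1} y = ennreal (b / y * ((ln (y / b)) ^ k / fact k)) * indicator {b..a} y"
      proof eventually_elim
        case (elim y)
        consider "y < b" | "b < y" "y < a" | "a < y" using elim by linarith
        then show ?case
        proof cases
          case 2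
          then have "- ln (b / y) = ln (y / b)" using "0.prems" by (simp add: ln_div)
          then show ?thesis using 2 "0.prems"
            by (simp add: case_nat_in_poisson_band_0 emeasure_poisson_band)
        qed (use "0.prems" in \<open>auto simp: case_nat_in_poisson_band_0\<close>)
      qed
    qed
    also have "\<dots> = ennreal (b * (ln (a / b)) ^ Suc k / fact (Suc k))"
      using "0.prems" by (intro nn_integral_log_power_over) auto
    finally show ?thesis by (simp add: poisson_joint_def)
  qed
next
  case (Suc i)
  show ?case
  proof (cases j)
    case [simp]: 0
    have "emeasure P_unif (poisson_band (Suc i) a \<inter> poisson_band 0 b) =
       (\<integral>\<^sup>+y. emeasure P_unif (poisson_band i (a / y) \<inter> {\<omega>. case_nat y \<omega> \<in> poisson_band 0 b}) *
        indicator {a<..1} y \<partial>lborel)"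
      using Suc.prems by (intro emeasure_poisson_band_Suc) auto
    also have "\<dots> = (\<integral>\<^sup>+y. 0 \<partial>(lborel :: real measure))"
      using Suc.prems by (intro nn_integral_cong) (auto simp: case_nat_in_poisson_band_0 indicator_def)
    finally show ?thesis by (simp add: poisson_joint_def)
  next
    case [simp]: (Suc k)
    have "emeasure P_unif (poisson_band (Suc i) a \<inter> poisson_band (Suc k) b) =
       (\<integral>\<^sup>+y. emeasure P_unif (poisson_band i (a / y) \<inter> {\<omega>. case_nat y \<omega> \<in> poisson_band (Suc k) b}) *
        indicator {a<..1} y \<partial>lborel)"
      using Suc.prems by (intro emeasure_poisson_band_Suc) auto
    also have "\<dots> = (\<integral>\<^sup>+y. ennreal ((if i \<le> k then b * ((ln (a / b)) ^ (k - i) / fact (k - i)) else 0)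
         / y * ((ln (y / a)) ^ i / fact i)) * indicator {a..1} y \<partial>lborel)"
    proof (intro nn_integral_cong_AE)
      have "AE y in lborel. y \<noteq> a"
        by (rule AE_lborel_singleton)
      then show "AE y in lborel. emeasure P_unif (poisson_band i (a / y) \<inter> {\<omega>. case_nat y \<omega> \<in> poisson_band (Suc k) b}) *
        indicator {a<..1} y = ennreal ((if i \<le> k then b * ((ln (a / b)) ^ (k - i) / fact (k - i)) else 0)
         / y * ((ln (y / a)) ^ i / fact i)) * indicator {a..1} y"
      proof eventually_elim
        case (elim y)
        show ?case
        proof (cases "a < y \<and> y \<le> 1")
          case True
          then have "- ln (a / y) = ln (y / a)" using Suc.prems by (simp add: ln_div)
          moreover have "emeasure P_unif (poisson_band i (a / y) \<inter> poisson_band k (b / y))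
            = ennreal (poisson_joint i k (a / y) (b / y))"
            using Suc.prems True by (intro Suc.IH) (auto simp: field_simps)
          ultimately show ?thesis using True Suc.prems
            by (simp add: case_nat_in_poisson_band_Suc poisson_joint_def mult_ac)
        qed (use elim in \<open>auto simp: indicator_def\<close>)
      qed
    qed
    also have "\<dots> = ennreal ((if i \<le> k then b * ((ln (a / b)) ^ (k - i) / fact (k - i)) else 0)
       * (ln (1 / a)) ^ Suc i / fact (Suc i))"
      using Suc.prems by (intro nn_integral_log_power_over) auto
    also have "\<dots> = ennreal (poisson_joint (Suc i) (Suc k) a b)"
      using Suc.prems by (simp add: poisson_joint_def ln_div mult_ac del: power_Suc fact_Suc)
    finally show ?thesis by simp
  qed
qed

section \<open>Covariances of the band integrals\<close>

text \<open>Each \<open>psi j\<close> with j > 0 has derivative \<open>psi (j - 1)\<close> minus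
  \<open>psi j\<close>, so the sum telescopes.\<close>

lemma has_real_derivative_poisson_cdf:
  "((\<lambda>s. \<Sum>j\<le>k. psi j s) has_real_derivative - psi k s) (at s)"
proof (induction k)
  case 0
  show ?case unfolding psi_def by (auto intro!: derivative_eq_intros)
next
  case (Suc k)
  have fact: "real (Suc k) / fact (Suc k) = 1 / fact k"
    by (simp add: field_simps del: of_nat_Suc)
  have "(psi (Suc k) has_real_derivative
      (real (Suc k) / fact (Suc k)) * s ^ k * exp (- s) - psi (Suc k) s) (at s)"
    unfolding psi_def[abs_def]
    by (auto intro!: derivative_eq_intros simp: field_simps simp del: of_nat_Suc fact_Suc power_Suc)
  also have "(real (Suc k) / fact (Suc k)) * s ^ k * exp (- s) = psi k s"
    by (simp only: fact) (simp add: psi_def)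
  finally show ?case
    using DERIV_add[OF Suc] by fastforce
qed

lemma psi_tendsto_0_at_top: "(psi k \<longlongrightarrow> 0) at_top"
proof -
  have "((\<lambda>s::real. (s ^ k / exp s) / fact k) \<longlongrightarrow> 0 / fact k) at_top"
    by (rule tendsto_divide[OF tendsto_power_div_exp_0 tendsto_const]) simp
  then show ?thesis by (simp add: psi_def[abs_def] exp_minus field_simps)
qed

lemma isCont_psi: "isCont (psi k) s"
  unfolding psi_def[abs_def] by (intro continuous_intros) auto

lemma filterlim_scaled_exp_minus_at_top: "((\<lambda>x. c * exp (- x :: real)) \<longlongrightarrow> 0) at_top"
  using tendsto_mult[OF tendsto_const[of c] filterlim_compose[OF exp_at_bot filterlim_uminus_at_bot_at_top]]
  by simp

lemma filterlim_scaled_exp_minus_at_bot: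
  assumes "0 < (c::real)" shows "filterlim (\<lambda>x. c * exp (- x)) at_top at_bot"
  using assms
  by (intro filterlim_tendsto_pos_mult_at_top[OF tendsto_const]
      filterlim_compose[OF exp_at_top filterlim_uminus_at_top_at_bot])

text \<open>The Gamma integral after the substitution s = c \<open>exp (- x)\<close>. The Poisson
  distribution function evaluated at this s is an antiderivative up to a constant factor and rises
  from 0 to 1, so no change of variables is needed.\<close>

lemma has_bochner_integral_gumbel:
  fixes c :: real
  assumes "0 < c"
  shows "has_bochner_integral lborel (\<lambda>x. exp (- x) ^ Suc k * exp (- (c * exp (- x))))
    (fact k / c ^ Suc k)"
proof -
  define F where "F x = (\<Sum>j\<le>k. psi j (c * exp (- x)))" for x
  define f where "f x = c * exp (- x) * psi k (c * exp (- x))" for x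
  have F: "(F has_real_derivative f x) (at x)" for x
    unfolding F_def f_def
    by (rule DERIV_chain2[OF has_real_derivative_poisson_cdf, THEN DERIV_cong])
       (auto intro!: derivative_eq_intros)
  have f: "isCont f x" for x
    unfolding f_def psi_def by (intro continuous_intros) auto
  have f0: "0 \<le> f x" for x
    using assms by (simp add: f_def psi_def)
  have bot: "(F \<longlongrightarrow> 0) at_bot"
    unfolding F_def
    by (intro tendsto_null_sum filterlim_compose[OF psi_tendsto_0_at_top]
        filterlim_scaled_exp_minus_at_bot assms)
  have top: "(F \<longlongrightarrow> 1) at_top"
  proof -
    have "(\<Sum>j\<le>k. psi j 0) = 1"
      by (induction k) (auto simp: psi_def)
    moreover have "(F \<longlongrightarrow> (\<Sum>j\<le>k. psi j 0)) at_top"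
      unfolding F_def
      by (intro tendsto_sum isCont_tendsto_compose[OF isCont_psi] filterlim_scaled_exp_minus_at_top)
    ultimately show ?thesis by simp
  qed
  have *: "set_integrable lborel (einterval (-\<infinity>) \<infinity>) f" "(LBINT x=-\<infinity>..\<infinity>. f x) = 1 - 0"
    by (rule interval_integral_FTC_nonneg[where F=F];
        use F f f0 bot top in \<open>simp add: ereal_tendsto_simps1\<close>)+
  then have "has_bochner_integral lborel f 1"
    by (simp add: has_bochner_integral_iff set_integrable_def interval_integral_eq_integral
        interval_lebesgue_integral_def set_lebesgue_integral_def)
  from has_bochner_integral_mult_right[OF this, of "fact k / c ^ Suc k"]
  show ?thesis using assms
    by (simp add: f_def psi_def power_mult_distrib mult_ac)
qed

text \<open>Frullani's argument: the difference is an integral over a parameter w between c and d,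
  Tonelli exchanges the two integrals, and the Gamma integral with k = 0 leaves 1 / w.\<close>

lemma has_bochner_integral_gumbel_diff:
  fixes c d :: real
  assumes "0 < c" "c \<le> d"
  shows "has_bochner_integral lborel (\<lambda>x. exp (- (c * exp (- x))) - exp (- (d * exp (- x)))) (ln (d / c))"
proof (rule has_bochner_integral_nn_integral)
  have inner: "ennreal (exp (- (c * exp (- x))) - exp (- (d * exp (- x)))) =
     (\<integral>\<^sup>+w. ennreal (exp (- x) * exp (- (w * exp (- x)))) * indicator {c..d} w \<partial>lborel)" for x
  proof -
    have "(\<integral>\<^sup>+w. ennreal (exp (- x) * exp (- (w * exp (- x)))) * indicator {c..d} w \<partial>lborel)
      = ennreal (- exp (- (d * exp (- x))) - (- exp (- (c * exp (- x)))))"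
      using assms by (intro nn_integral_FTC_Icc) (auto intro!: derivative_eq_intros)
    then show ?thesis by simp
  qed
  have "(\<integral>\<^sup>+x. ennreal (exp (- (c * exp (- x))) - exp (- (d * exp (- x)))) \<partial>lborel) =
    (\<integral>\<^sup>+w. (\<integral>\<^sup>+x. ennreal (exp (- x) * exp (- (w * exp (- x)))) * indicator {c..d} w \<partial>lborel) \<partial>lborel)"
    unfolding inner by (rule lborel_pair.Fubini') measurable
  also have "\<dots> = (\<integral>\<^sup>+w. ennreal (1 / w) * indicator {c..d} w \<partial>lborel)"
  proof (intro nn_integral_cong)
    fix w :: real
    show "(\<integral>\<^sup>+x. ennreal (exp (- x) * exp (- (w * exp (- x)))) * indicator {c..d} w \<partial>lborel) =
        ennreal (1 / w) * indicator {c..d} w"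
    proof (cases "w \<in> {c..d}")
      case True
      then have "has_bochner_integral lborel (\<lambda>x. exp (- x) * exp (- (w * exp (- x)))) (1 / w)"
        using has_bochner_integral_gumbel[of w 0] assms by simp
      then show ?thesis using True
        by (subst nn_integral_multc) (auto simp: nn_integral_eq_integral has_bochner_integral_iff)
    qed simp
  qed
  also have "\<dots> = ennreal (ln d - ln c)"
    using assms by (intro nn_integral_FTC_Icc) (auto intro!: derivative_eq_intros)
  also have "ln d - ln c = ln (d / c)" using assms by (simp add: ln_div)
  finally show "(\<integral>\<^sup>+x. ennreal (exp (- (c * exp (- x))) - exp (- (d * exp (- x)))) \<partial>lborel) = ennreal (ln (d / c))" .
qed (use assms in auto)

text \<open>The parameter is q = \<open>exp (u - v)\<close> for u \<le> v. The first part comes from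
  the joint probability and the subtracted one from the product of the marginals; for i = j = 0 only
  the Frullani integral of their difference makes sense.\<close>

definition band_cov :: "nat \<Rightarrow> nat \<Rightarrow> real \<Rightarrow> real" where
  "band_cov i j q = (if i = 0 \<and> j = 0 then ln (1 + q) else
     (if i \<le> j then 1 / real j * real (j choose i) * (1 - q) ^ (j - i) * q ^ i else 0)
     - 1 / real (i + j) * real ((i + j) choose i) * q ^ i / (1 + q) ^ (i + j))"

lemma has_bochner_integral_band_cov:
  assumes "u \<le> v"
  shows "has_bochner_integral lborel
    (\<lambda>x. poisson_joint i j (exp (- exp (- (x - u)))) (exp (- exp (- (x - v))))
        - psi i (exp (- (x - u))) * psi j (exp (- (x - v))))
    (band_cov i j (exp (u - v)))"
proof -
  define U V where "U = exp u" and "V = exp v"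
  have UV: "0 < U" "U \<le> V" "0 < V" using assms by (auto simp: U_def V_def)
  have q: "exp (u - v) = U / V" by (simp add: U_def V_def exp_diff)
  have s: "exp (- (x - u)) = U * exp (- x)" "exp (- (x - v)) = V * exp (- x)" for x
    by (simp_all add: U_def V_def exp_minus exp_diff field_simps)
  have joint: "poisson_joint i j (exp (- exp (- (x - u)))) (exp (- exp (- (x - v)))) =
      (if i \<le> j then U ^ i * (V - U) ^ (j - i) / (fact i * fact (j - i)) *
        (exp (- x) ^ j * exp (- (V * exp (- x)))) else 0)" for x
  proof -
    have "ln (exp (- (U * exp (- x))) / exp (- (V * exp (- x)))) = (V - U) * exp (- x)"
      by (simp add: ln_div algebra_simps)
    moreover have "exp (- x) ^ j = exp (- x) ^ i * exp (- x) ^ (j - i)" if "i \<le> j"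
      using that by (simp flip: power_add)
    ultimately show ?thesis
      unfolding poisson_joint_def s by (simp add: power_mult_distrib mult_ac)
  qed
  have prod: "psi i (exp (- (x - u))) * psi j (exp (- (x - v))) =
      U ^ i * V ^ j / (fact i * fact j) * (exp (- x) ^ (i + j) * exp (- ((U + V) * exp (- x))))" for x
  proof -
    have "exp (- ((U + V) * exp (- x))) = exp (- (U * exp (- x))) * exp (- (V * exp (- x)))"
      by (simp add: ring_distribs flip: exp_add)
    then show ?thesis
      unfolding psi_def s by (simp add: power_mult_distrib power_add)
  qed
  show ?thesis
  \<comment> \<open>Outside this case a positive power of \<open>exp (- x)\<close> occurs in each
    nonzero part, so the two parts may be integrated separately.\<close>
  proof (cases "i = 0 \<and> j = 0")
    case True
    have "has_bochner_integral lborel (\<lambda>x. exp (- (V * exp (- x))) - exp (- ((U + V) * exp (- x))))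
      (ln ((U + V) / V))"
      using UV by (intro has_bochner_integral_gumbel_diff) auto
    then show ?thesis unfolding joint prod q
      using True UV by (simp add: band_cov_def add_divide_distrib add.commute)
  next
    case False
    have first: "has_bochner_integral lborel (\<lambda>x. if i \<le> j then U ^ i * (V - U) ^ (j - i) / (fact i * fact (j - i)) *
        (exp (- x) ^ j * exp (- (V * exp (- x)))) else 0)
      (if i \<le> j then 1 / real j * real (j choose i) * (1 - U / V) ^ (j - i) * (U / V) ^ i else 0)"
    proof (cases "i \<le> j")
      case True
      with False obtain k where k: "j = Suc k" by (cases j) auto
      have "has_bochner_integral lborel (\<lambda>x. U ^ i * (V - U) ^ (j - i) / (fact i * fact (j - i)) *
        (exp (- x) ^ j * exp (- (V * exp (- x))))) (U ^ i * (V - U) ^ (j - i) / (fact i * fact (j - i)) *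
          (fact k / V ^ j))"
        unfolding k using UV by (intro has_bochner_integral_mult_right has_bochner_integral_gumbel)
      also have "U ^ i * (V - U) ^ (j - i) / (fact i * fact (j - i)) * (fact k / V ^ j) =
        1 / real j * real (j choose i) * (1 - U / V) ^ (j - i) * (U / V) ^ i"
      proof -
        have "1 - U / V = (V - U) / V" using UV by (simp add: field_simps)
        moreover have "V ^ j = V ^ (j - i) * V ^ i" using True by (simp flip: power_add)
        moreover have "real (j choose i) = real j * fact k / (fact i * fact (j - i))"
          using True by (simp add: binomial_fact k)
        moreover have "real j \<noteq> 0" by (simp add: k)
        ultimately show ?thesis
          by (simp add: power_divide mult_ac)
      qed
      finally show ?thesis using True by simp
    qed (simp add: has_bochner_integral_zero)
    have second: "has_bochner_integral lborel
        (\<lambda>x. U ^ i * V ^ j / (fact i * fact j) * (exp (- x) ^ (i + j) * exp (- ((U + V) * exp (- x)))))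
      (1 / real (i + j) * real ((i + j) choose i) * (U / V) ^ i / (1 + U / V) ^ (i + j))"
    proof -
      from False obtain k where k: "i + j = Suc k" by (cases "i + j") auto
      have "has_bochner_integral lborel
        (\<lambda>x. U ^ i * V ^ j / (fact i * fact j) * (exp (- x) ^ (i + j) * exp (- ((U + V) * exp (- x)))))
        (U ^ i * V ^ j / (fact i * fact j) * (fact k / (U + V) ^ (i + j)))"
        unfolding k using UV by (intro has_bochner_integral_mult_right has_bochner_integral_gumbel) auto
      also have "U ^ i * V ^ j / (fact i * fact j) * (fact k / (U + V) ^ (i + j)) =
        1 / real (i + j) * real ((i + j) choose i) * (U / V) ^ i / (1 + U / V) ^ (i + j)"
      proof -
        have "1 + U / V = (U + V) / V" using UV by (simp add: field_simps)
        moreover have "real ((i + j) choose i) = real (i + j) * fact k / (fact i * fact j)"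
        proof -
          have "real ((i + j) choose i) = fact (i + j) / (fact i * fact j)"
            using binomial_fact[of i "i + j", where 'a = real] by simp
          also have "fact (i + j) = real (i + j) * fact k" by (simp add: k)
          finally show ?thesis .
        qed
        moreover have "real (i + j) \<noteq> 0" using k by simp
        ultimately show ?thesis
          using UV by (simp add: power_divide power_add field_simps del: of_nat_add)
      qed
      finally show ?thesis .
    qed
    show ?thesis unfolding joint prod q band_cov_def if_not_P[OF False]
      by (rule has_bochner_integral_diff[OF first second])
  qed
qed

section \<open>Inner products of the integrands\<close>

definition band_kernel :: "nat \<Rightarrow> real \<Rightarrow> real \<times> (nat \<Rightarrow> real) \<Rightarrow> real" where
  "band_kernel k u = (\<lambda>(x, y).
      (if (\<Prod>i<k+1. y i) < psi 0 (exp (- (x - u))) \<and> psi 0 (exp (- (x - u))) < (\<Prod>i<k. y i)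
       then 1 else 0) - psi k (exp (- (x - u))))"

lemma borel_measurable_psi [measurable]: "psi k \<in> borel_measurable borel"
  unfolding psi_def[abs_def] by measurable

lemma band_kernel_measurable [measurable]: "band_kernel k u \<in> borel_measurable intensity"
  unfolding band_kernel_def intensity_def by measurable

lemma band_kernel_eq:
  "band_kernel k u (x, y) =
    indicator (poisson_band k (exp (- exp (- (x - u))))) y - psi k (exp (- (x - u)))"
  by (simp add: band_kernel_def poisson_band_def psi_def[of 0] indicator_def)

lemma measure_poisson_band:
  "measure P_unif (poisson_band k (exp (- exp s))) = psi k (exp s)"
  using emeasure_poisson_band[of "exp (- exp s)" k]
  by (simp add: measure_def psi_def mult.commute)

lemma band_kernel_inner:
  assumes "u \<le> v"
  shows "has_bochner_integral P_unif (\<lambda>y. band_kernel i u (x, y) * band_kernel j v (x, y))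
    (poisson_joint i j (exp (- exp (- (x - u)))) (exp (- exp (- (x - v))))
        - psi i (exp (- (x - u))) * psi j (exp (- (x - v))))"
proof -
  let ?A = "poisson_band i (exp (- exp (- (x - u))))" and ?B = "poisson_band j (exp (- exp (- (x - v))))"
  let ?p = "psi i (exp (- (x - u)))" and ?q = "psi j (exp (- (x - v)))"
  have AB: "measure P_unif (?A \<inter> ?B) = poisson_joint i j (exp (- exp (- (x - u)))) (exp (- exp (- (x - v))))"
  proof -
    have "emeasure P_unif (?A \<inter> ?B) =
        ennreal (poisson_joint i j (exp (- exp (- (x - u)))) (exp (- exp (- (x - v)))))"
      using assms by (intro emeasure_poisson_joint) auto
    moreover have "0 \<le> poisson_joint i j (exp (- exp (- (x - u)))) (exp (- exp (- (x - v))))"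
      using assms by (auto simp: poisson_joint_def ln_div intro!: mult_nonneg_nonneg divide_nonneg_nonneg)
    ultimately show ?thesis by (simp add: measure_def)
  qed
  have ind: "has_bochner_integral P_unif (indicator A :: _ \<Rightarrow> real) (measure P_unif A)"
    if "A \<in> sets P_unif" for A
    using that by (intro has_bochner_integral_real_indicator) (auto simp: P_unif.emeasure_eq_measure)
  have const: "has_bochner_integral P_unif (\<lambda>_. c) c" for c :: real
    using P_unif.prob_space by (simp add: has_bochner_integral_iff)
  have "has_bochner_integral P_unif
      (\<lambda>y. indicator (?A \<inter> ?B) y - ?p * indicator ?B y - ?q * indicator ?A y + ?p * ?q)
      (measure P_unif (?A \<inter> ?B) - ?p * measure P_unif ?B - ?q * measure P_unif ?A + ?p * ?q)"
    by (intro has_bochner_integral_add has_bochner_integral_diff has_bochner_integral_mult_right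
        ind const) auto
  also have "(\<lambda>y. indicator (?A \<inter> ?B) y - ?p * indicator ?B y - ?q * indicator ?A y + ?p * ?q) =
      (\<lambda>y. band_kernel i u (x, y) * band_kernel j v (x, y))"
    by (auto simp: band_kernel_eq indicator_inter_arith algebra_simps)
  finally show ?thesis unfolding AB measure_poisson_band by (simp add: mult.commute)
qed

interpretation intensity: pair_sigma_finite lborel P_unif ..

text \<open>Integrating over y first gives the variance of the band event, and its integral over x
  is the covariance formula on the diagonal i = j, u = v.\<close>

lemma square_integrable_band_kernel: "square_integrable intensity (band_kernel k u)"
proof -
  have "integrable (lborel \<Otimes>\<^sub>M P_unif) (\<lambda>z. (band_kernel k u z)\<^sup>2)"
  proof (rule intensity.Fubini_integrable)
    show "(\<lambda>z. (band_kernel k u z)\<^sup>2) \<in> borel_measurable (lborel \<Otimes>\<^sub>M P_unif)"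
      using band_kernel_measurable[of k u] unfolding intensity_def by measurable
    show "integrable lborel (\<lambda>x. \<integral>y. norm ((band_kernel k u (x, y))\<^sup>2) \<partial>P_unif)"
      using band_kernel_inner[of u u k _ k] has_bochner_integral_band_cov[of u u k k]
      by (simp add: power2_eq_square has_bochner_integral_iff)
    show "AE x in lborel. integrable P_unif (\<lambda>y. (band_kernel k u (x, y))\<^sup>2)"
      using band_kernel_inner[of u u k _ k]
      by (simp add: power2_eq_square has_bochner_integral_iff)
  qed
  then show ?thesis
    by (simp add: square_integrable_def flip: intensity_def)
qed

lemma integral_band_kernel_mult:
  assumes "u \<le> v"
  shows "(\<integral>z. band_kernel i u z * band_kernel j v z \<partial>intensity) = band_cov i j (exp (u - v))"
proof -
  have "(\<integral>z. band_kernel i u z * band_kernel j v z \<partial>intensity) =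
    (\<integral>x. (\<integral>y. band_kernel i u (x, y) * band_kernel j v (x, y) \<partial>P_unif) \<partial>lborel)"
    using square_integrable_mult[OF square_integrable_band_kernel square_integrable_band_kernel]
    unfolding intensity_def by (subst intensity.integral_fst') auto
  also have "\<dots> = band_cov i j (exp (u - v))"
    using band_kernel_inner[OF assms] has_bochner_integral_band_cov[OF assms]
    by (simp add: has_bochner_integral_iff)
  finally show ?thesis .
qed

section \<open>Summation of the covariances\<close>

text \<open>In independent trials with success probability \<open>p\<close> and failure probability \<open>r\<close>, this is the
  probability that the \<open>(a + 1)\<close>-st success precedes the \<open>b\<close>-th failure.\<close>

definition success_first :: "real \<Rightarrow> real \<Rightarrow> nat \<Rightarrow> nat \<Rightarrow> real" where
  "success_first p r a b = (\<Sum>i<b. real ((a + i) choose i) * p ^ Suc a * r ^ i)"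

text \<open>Conditioning on the first trial. As an identity in p and r it is Pascal's rule and does
  not rely on p + r = 1.\<close>

lemma success_first_Suc_Suc:
  "success_first p r (Suc a) (Suc b) = p * success_first p r a (Suc b) + r * success_first p r (Suc a) b"
proof (induction b)
  case 0
  then show ?case by (simp add: success_first_def)
next
  case (Suc b)
  have step: "success_first p r a (Suc b) = success_first p r a b + real ((a + b) choose b) * p ^ Suc a * r ^ b" for a b
    by (simp add: success_first_def)
  have pascal: "(Suc a + Suc b) choose Suc b = ((a + Suc b) choose Suc b) + ((Suc a + b) choose b)"
    by (simp add: add.commute)
  have "success_first p r (Suc a) (Suc (Suc b)) =
      p * success_first p r a (Suc b) + r * success_first p r (Suc a) b +
      real (((a + Suc b) choose Suc b) + ((Suc a + b) choose b)) * p ^ Suc (Suc a) * r ^ Suc b"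
    by (simp only: step[of "Suc a" "Suc b"] Suc.IH pascal)
  then show ?case
    unfolding step[of a "Suc b"] step[of "Suc a" b] by (simp add: algebra_simps del: binomial_Suc_Suc)
qed

lemma success_first_0:
  assumes "p + r = 1"
  shows "success_first p r 0 b = 1 - r ^ b"
proof -
  have "p = 1 - r" using assms by simp
  then show ?thesis
    using one_diff_power_eq[of r b] by (simp add: success_first_def flip: sum_distrib_left)
qed

text \<open>Exactly one of the two thresholds is reached first. The recursion by the first trial
  reduces the claim to smaller a or smaller b, hence the nested inductions.\<close>

lemma success_first_complement:
  assumes "p + r = 1"
  shows "success_first p r a (Suc b) + success_first r p b (Suc a) = 1"
proof (induction a arbitrary: b)
  case 0
  have "success_first r p b (Suc 0) = r ^ Suc b" by (simp add: success_first_def)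
  then show ?case by (simp add: success_first_0[OF assms] del: power_Suc)
next
  case (Suc a)
  show ?case
  proof (induction b)
    case 0
    have "success_first p r (Suc a) (Suc 0) = p ^ Suc (Suc a)" by (simp add: success_first_def)
    then show ?case using assms by (simp add: success_first_0 add.commute del: power_Suc)
  next
    case (Suc b)
    have "success_first p r (Suc a) (Suc (Suc b)) + success_first r p (Suc b) (Suc (Suc a)) =
      p * (success_first p r a (Suc (Suc b)) + success_first r p (Suc b) (Suc a)) +
      r * (success_first p r (Suc a) (Suc b) + success_first r p b (Suc (Suc a)))"
      by (simp only: success_first_Suc_Suc) (simp add: algebra_simps)
    also have "\<dots> = p * 1 + r * 1"
      by (simp only: Suc.IH \<open>\<And>b. success_first p r a (Suc b) + success_first r p b (Suc a) = 1\<close>)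
    finally show ?case using assms by simp
  qed
qed

text \<open>The new row and column contribute (1 - \<open>q ^ l\<close>) / l from the joint
  probabilities and -1 / l from the products; the term \<open>q ^ l\<close> / l of the diagonal
  entry cancels what is left of these, and its central binomial term remains.\<close>

lemma band_cov_border:
  assumes "1 \<le> l" "0 < q"
  shows "band_cov l l q + (\<Sum>i<l. band_cov i l q + band_cov l i q) =
    - (fact (2 * l - 1) * q ^ l / ((fact l)\<^sup>2 * (1 + q) ^ (2 * l)))"
proof -
  \<comment> \<open>With these Bernoulli parameters the powers of q over 1 + q in the (i, l) and (l,
    i) entries become the weights of the two competing outcomes.\<close>
  define p r where "p = 1 / (1 + q)" and "r = q / (1 + q)"
  have pr: "p + r = 1" using assms by (simp add: p_def r_def field_simps)
  obtain m where m: "l = Suc m" using assms by (cases l) auto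
  have diag: "band_cov l l q = 1 / real l * q ^ l - fact (2 * l - 1) * q ^ l / ((fact l)\<^sup>2 * (1 + q) ^ (2 * l))"
  proof -
    have "real ((l + l) choose l) = fact (2 * l) / (fact l)\<^sup>2"
      using binomial_fact[of l "l + l", where 'a = real] by (simp add: power2_eq_square mult_2)
    also have "fact (2 * l) = real (2 * l) * fact (2 * l - 1)"
      by (simp add: m)
    finally have "1 / real (l + l) * real ((l + l) choose l) = fact (2 * l - 1) / (fact l)\<^sup>2"
      using assms by simp
    then have "1 / real (l + l) * real ((l + l) choose l) * q ^ l / (1 + q) ^ (l + l) =
      fact (2 * l - 1) / (fact l)\<^sup>2 * q ^ l / (1 + q) ^ (l + l)"
      by (simp only:)
    also have "\<dots> = fact (2 * l - 1) * q ^ l / ((fact l)\<^sup>2 * (1 + q) ^ (2 * l))"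
      by (simp only: mult_2 times_divide_eq_left divide_divide_eq_left)
    finally show ?thesis using assms unfolding band_cov_def by simp
  qed
  have off: "band_cov i l q + band_cov l i q = 1 / real l * (real (l choose i) * q ^ i * (1 - q) ^ (l - i)) -
      1 / real l * (real ((m + i) choose i) * p ^ Suc m * r ^ i + real ((m + i) choose i) * r ^ Suc m * p ^ i)"
    if "i < l" for i
  proof -
    \<comment> \<open>Absorption replaces the prefactor depending on i by the constant 1 / l, and
      produces the binomial coefficients of the trial identity.\<close>
    have c: "1 / real (l + i) * real ((l + i) choose i) = 1 / real l * real ((m + i) choose i)"
    proof -
      have "l * ((l + i) choose i) = (l + i) * ((m + i) choose i)"
        using binomial_absorb_comp[of "l + i" i] by (simp add: m)
      then have "real l * real ((l + i) choose i) = real (l + i) * real ((m + i) choose i)"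
        by (simp only: flip: of_nat_mult)
      then show ?thesis using assms by (simp add: field_simps)
    qed
    have sym: "(l + i) choose l = (l + i) choose i"
      using binomial_symmetric[of l "l + i"] by simp
    have e1: "p ^ Suc m * r ^ i = q ^ i / (1 + q) ^ (l + i)"
      and e2: "r ^ Suc m * p ^ i = q ^ l / (1 + q) ^ (l + i)"
      by (simp_all add: p_def r_def power_divide power_add m)
    have "band_cov i l q + band_cov l i q = 1 / real l * (real (l choose i) * q ^ i * (1 - q) ^ (l - i))
      - 1 / real (l + i) * real ((l + i) choose i) * (q ^ i / (1 + q) ^ (l + i))
      - 1 / real (l + i) * real ((l + i) choose i) * (q ^ l / (1 + q) ^ (l + i))"
      using that by (simp add: band_cov_def add.commute[of i l] sym mult_ac)
    then show ?thesis
      unfolding c e1[symmetric] e2[symmetric] by (simp add: algebra_simps)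
  qed
  have binom: "(\<Sum>i<l. real (l choose i) * q ^ i * (1 - q) ^ (l - i)) = 1 - q ^ l"
  proof -
    have "1 = (q + (1 - q)) ^ l" by simp
    also have "\<dots> = (\<Sum>i\<le>l. real (l choose i) * q ^ i * (1 - q) ^ (l - i))"
      by (rule binomial_ring)
    also have "\<dots> = (\<Sum>i<l. real (l choose i) * q ^ i * (1 - q) ^ (l - i)) + q ^ l"
      by (simp add: lessThan_Suc_atMost[symmetric])
    finally show ?thesis by simp
  qed
  have match: "(\<Sum>i<l. real ((m + i) choose i) * p ^ Suc m * r ^ i + real ((m + i) choose i) * r ^ Suc m * p ^ i) = 1"
    using success_first_complement[OF pr, of m m]
    by (simp add: success_first_def m sum.distrib del: power_Suc)
  have "(\<Sum>i<l. band_cov i l q + band_cov l i q) = 1 / real l * (1 - q ^ l) - 1 / real l * 1"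
  proof -
    have "(\<Sum>i<l. band_cov i l q + band_cov l i q) =
      (\<Sum>i<l. 1 / real l * (real (l choose i) * q ^ i * (1 - q) ^ (l - i)) -
      1 / real l * (real ((m + i) choose i) * p ^ Suc m * r ^ i + real ((m + i) choose i) * r ^ Suc m * p ^ i))"
      by (intro sum.cong off) auto
    then show ?thesis
      by (simp only: sum_subtractf sum_distrib_left[symmetric] binom match)
  qed
  then show ?thesis using diag by (simp add: algebra_simps)
qed

lemma sum_band_cov:
  assumes "1 \<le> l" "0 < q"
  shows "(\<Sum>i<l. \<Sum>j<l. band_cov i j q) =
    ln (1 + q) - (\<Sum>k\<in>{1..<l}. fact (2 * k - 1) * q ^ k / ((fact k)\<^sup>2 * (1 + q) ^ (2 * k)))"
  using assms(1)
proof (induction l rule: nat_induct_at_least)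
  case base
  show ?case by (simp add: band_cov_def)
next
  case (Suc l)
  have "(\<Sum>i<Suc l. \<Sum>j<Suc l. band_cov i j q) =
    (\<Sum>i<l. \<Sum>j<l. band_cov i j q) + (band_cov l l q + (\<Sum>i<l. band_cov i l q + band_cov l i q))"
    by (simp add: sum.distrib)
  then show ?case
    using Suc band_cov_border[OF Suc.hyps assms(2)] by simp
qed

lemma sum_band_cov_exp:
  assumes "1 \<le> l"
  shows "(\<Sum>i<l. \<Sum>j<l. band_cov i j (exp (- \<bar>t\<bar>))) = cov_Z l t"
  using assms by (simp add: sum_band_cov cov_Z_def exp_of_nat2_mult[symmetric] mult.commute)

section \<open>The processes \<open>Z\<^sub>l\<close>\<close>

lemma cov_Z_even: "cov_Z l (- t) = cov_Z l t"
  by (simp add: cov_Z_def)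

text \<open>As a function of the absolute value of t the covariance is differentiable at 0, so its
  cusp is at most linear; away from 0 the drop is bounded, which is again linear in t.\<close>

lemma cov_Z_lipschitz_at_0: "\<exists>C\<ge>0. \<forall>t. cov_Z l 0 - cov_Z l t \<le> C * \<bar>t\<bar>"
proof -
  define h where "h k t = fact (2*k - 1) * exp (- t * real k) / ((fact k)\<^sup>2 * (1 + exp (- t)) ^ (2*k))" for k and t :: real
  define g where "g t = ln (1 + exp (- t)) - (\<Sum>k\<in>{1..<l}. h k t)" for t
  have cov: "cov_Z l t = g \<bar>t\<bar>" for t
    by (simp add: cov_Z_def g_def h_def)
  have "\<exists>D. (h k has_real_derivative D) (at 0)" for k
    unfolding h_def by (rule exI) (rule derivative_eq_intros refl | simp)+
  then obtain D where D: "\<And>k. (h k has_real_derivative D k) (at 0)" by metis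
  have "(g has_real_derivative - (1 / 2) - (\<Sum>k\<in>{1..<l}. D k)) (at 0)"
    unfolding g_def by (auto intro!: derivative_eq_intros D)
  then obtain E where "(g has_real_derivative E) (at 0)" by blast
  then have "((\<lambda>t. (g t - g 0) / t) \<longlongrightarrow> E) (at 0)"
    by (simp add: has_field_derivative_iff)
  then have "\<forall>\<^sub>F t in at 0. dist ((g t - g 0) / t) E < 1"
    by (rule tendstoD) simp
  then obtain \<delta> where \<delta>: "0 < \<delta>" "\<And>t. t \<noteq> 0 \<Longrightarrow> \<bar>t\<bar> < \<delta> \<Longrightarrow> \<bar>(g t - g 0) / t - E\<bar> < 1"
    by (auto simp: eventually_at dist_real_def)
  \<comment> \<open>A crude bound on the drop for all t \<ge> 0: the logarithm is nonnegative, the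
    exponential at most 1 and the power in the denominator at least 1.\<close>
  define B where "B = \<bar>g 0\<bar> + (\<Sum>k\<in>{1..<l}. fact (2*k - 1) / (fact k)\<^sup>2 :: real)"
  have "0 \<le> B" unfolding B_def by (intro add_nonneg_nonneg sum_nonneg) auto
  have B: "g 0 - g t \<le> B" if "0 \<le> t" for t
  proof -
    have h: "h k t \<le> fact (2*k - 1) / (fact k)\<^sup>2" for k
    proof -
      have "h k t \<le> fact (2*k - 1) * 1 / ((fact k)\<^sup>2 * 1)"
        unfolding h_def using that by (intro frac_le mult_left_mono one_le_power) auto
      then show ?thesis by simp
    qed
    have "g 0 - g t \<le> \<bar>g 0\<bar> + (\<Sum>k\<in>{1..<l}. h k t)"
    proof -
      have "0 \<le> ln (1 + exp (- t))" by simp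
      then show ?thesis unfolding g_def[of t] using abs_ge_self[of "g 0"] by linarith
    qed
    also have "\<dots> \<le> B"
      unfolding B_def by (intro add_left_mono sum_mono h)
    finally show ?thesis .
  qed
  have "g 0 - g t \<le> (\<bar>E\<bar> + 1 + B / \<delta>) * t" if "0 \<le> t" for t
  proof (cases "t < \<delta>")
    case True
    show ?thesis
    proof (cases "t = 0")
      case False
      then have "\<bar>(g t - g 0) / t\<bar> \<le> \<bar>E\<bar> + 1" using \<delta>(2)[of t] True that by linarith
      then have "- ((g t - g 0) / t) \<le> \<bar>E\<bar> + 1" by linarith
      then have "g 0 - g t \<le> (\<bar>E\<bar> + 1) * t" using False that by (simp add: field_simps)
      also have "\<dots> \<le> (\<bar>E\<bar> + 1 + B / \<delta>) * t" using \<open>0 \<le> B\<close> \<delta>(1) that by (intro mult_right_mono) auto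
      finally show ?thesis .
    qed simp
  next
    case False
    have "g 0 - g t \<le> B / \<delta> * \<delta>" using B[OF that] \<delta>(1) by simp
    also have "\<dots> \<le> (\<bar>E\<bar> + 1 + B / \<delta>) * t" using False \<open>0 \<le> B\<close> \<delta>(1) by (intro mult_mono) auto
    finally show ?thesis .
  qed
  then show ?thesis using \<open>0 \<le> B\<close> \<delta>(1)
    by (intro exI[of _ "\<bar>E\<bar> + 1 + B / \<delta>"]) (auto simp: cov)
qed


section \<open>Integrands of the processes and their covariances\<close>

definition Z1_kernel :: "real \<Rightarrow> real \<times> (nat \<Rightarrow> real) \<Rightarrow> real" where
  "Z1_kernel u = (\<lambda>(x, y). (if y 0 \<le> exp (- exp (- (x - u))) then 1 else 0) - exp (- exp (- (x - u))))"

lemma Z1_kernel_measurable [measurable]: "Z1_kernel u \<in> borel_measurable intensity"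
  unfolding Z1_kernel_def intensity_def by measurable

text \<open>The kernels differ only in weak versus strict inequality for the first coordinate, that
  is, on a null set; the second condition of the band with k = 0 compares with the empty product 1
  and always holds here.\<close>

lemma AE_Z1_kernel: "AE z in intensity. Z1_kernel u z = band_kernel 0 u z"
  unfolding intensity_def
proof (rule intensity.AE_pair_measure)
  show "{z \<in> space (lborel \<Otimes>\<^sub>M P_unif). Z1_kernel u z = band_kernel 0 u z} \<in> sets (lborel \<Otimes>\<^sub>M P_unif)"
    using Z1_kernel_measurable[of u] band_kernel_measurable[of 0 u]
    unfolding intensity_def by measurable
  show "AE x in lborel. AE y in P_unif. Z1_kernel u (x, y) = band_kernel 0 u (x, y)"
  proof (rule AE_I2)
    fix x :: real
    have "AE y in unif01. y \<noteq> exp (- exp (- (x - u)))"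
    proof (rule AE_uniform_measureI)
      have "AE y in lborel. y \<noteq> exp (- exp (- (x - u)))" by (rule AE_lborel_singleton)
      then show "AE y in lborel. y \<in> {0..1} \<longrightarrow> y \<noteq> exp (- exp (- (x - u)))" by eventually_elim simp
    qed simp
    then have "AE y in P_unif. y 0 \<noteq> exp (- exp (- (x - u)))"
      unfolding P_unif_def by (intro AE_PiM_component prob_space_unif01) auto
    then show "AE y in P_unif. Z1_kernel u (x, y) = band_kernel 0 u (x, y)"
      by eventually_elim (auto simp: Z1_kernel_def band_kernel_def psi_def)
  qed
qed

lemma square_integrable_Z1_kernel: "square_integrable intensity (Z1_kernel u)"
proof -
  have "integrable intensity (\<lambda>z. (band_kernel 0 u z)\<^sup>2)"
    using square_integrable_band_kernel by (simp add: square_integrable_def)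
  moreover have "AE z in intensity. (band_kernel 0 u z)\<^sup>2 = (Z1_kernel u z)\<^sup>2"
    using AE_Z1_kernel[of u] by eventually_elim simp
  ultimately have "integrable intensity (\<lambda>z. (Z1_kernel u z)\<^sup>2)"
    by (rule_tac integrable_cong_AE[THEN iffD1, rotated 3]) auto
  then show ?thesis by (simp add: square_integrable_def)
qed

definition Z_kernel :: "nat \<Rightarrow> real \<Rightarrow> real \<times> (nat \<Rightarrow> real) \<Rightarrow> real" where
  "Z_kernel l u z = (\<Sum>k<l. - 1 * band_kernel k u z)"

lemma square_integrable_Z_kernel: "square_integrable intensity (Z_kernel l u)"
  unfolding Z_kernel_def[abs_def] by (intro square_integrable_sum square_integrable_band_kernel)

lemma integral_Z_kernel_mult:
  "(\<integral>z. Z_kernel l u z * Z_kernel l' v z \<partial>intensity) =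
    (\<Sum>i<l. \<Sum>j<l'. \<integral>z. band_kernel i u z * band_kernel j v z \<partial>intensity)"
proof -
  note int = square_integrable_mult[OF square_integrable_band_kernel square_integrable_band_kernel]
  have "(\<integral>z. Z_kernel l u z * Z_kernel l' v z \<partial>intensity) =
    (\<integral>z. (\<Sum>i<l. \<Sum>j<l'. band_kernel i u z * band_kernel j v z) \<partial>intensity)"
    by (simp add: Z_kernel_def sum_negf sum_product)
  also have "\<dots> = (\<Sum>i<l. \<integral>z. (\<Sum>j<l'. band_kernel i u z * band_kernel j v z) \<partial>intensity)"
    by (intro Bochner_Integration.integral_sum Bochner_Integration.integrable_sum int)
  also have "\<dots> = (\<Sum>i<l. \<Sum>j<l'. \<integral>z. band_kernel i u z * band_kernel j v z \<partial>intensity)"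
    by (intro sum.cong refl Bochner_Integration.integral_sum int)
  finally show ?thesis .
qed

lemma integral_band_kernel_mult':
  "(\<integral>z. band_kernel i u z * band_kernel j v z \<partial>intensity) =
    (if u \<le> v then band_cov i j (exp (u - v)) else band_cov j i (exp (v - u)))"
  using integral_band_kernel_mult[of u v i j] integral_band_kernel_mult[of v u j i]
  by (simp add: mult.commute)

lemma integral_Z_kernel_eq_cov_Z:
  assumes "1 \<le> l"
  shows "(\<integral>z. Z_kernel l u z * Z_kernel l v z \<partial>intensity) = cov_Z l (u - v)"
proof (cases "u \<le> v")
  case True
  then have "u - v = - \<bar>u - v\<bar>" by simp
  then show ?thesis
    using True sum_band_cov_exp[OF assms, of "u - v"]
    by (simp add: integral_Z_kernel_mult integral_band_kernel_mult')
next
  case False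
  then have "v - u = - \<bar>u - v\<bar>" by simp
  moreover have "(\<Sum>i<l. \<Sum>j<l. band_cov j i (exp (v - u))) = (\<Sum>i<l. \<Sum>j<l. band_cov i j (exp (v - u)))"
    by (rule sum.swap)
  ultimately show ?thesis
    using False sum_band_cov_exp[OF assms, of "u - v"]
    by (simp add: integral_Z_kernel_mult integral_band_kernel_mult')
qed

text \<open>One formula covers both orders of u and v. For u > v the roles of i and j swap and the
  joint probability vanishes, matched by the positive part raised to j - i > 0; the product term is
  invariant under swapping i with j and q with 1 / q.\<close>

lemma band_kernel_cross_term:
  assumes "i < j"
  shows "(\<integral>z. band_kernel i u z * band_kernel j v z \<partial>intensity) =
    1 / real j * real (j choose i) * (max 0 (1 - exp (u - v))) ^ (j - i) * exp ((u - v) * i)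
      - 1 / real (j + i) * real ((j + i) choose i) * exp ((u - v) * i) / (1 + exp (u - v)) ^ (j + i)"
proof -
  define q where "q = exp (u - v)"
  have q: "0 < q" by (simp add: q_def)
  have e: "exp ((u - v) * i) = q ^ i"
    by (simp add: q_def exp_of_nat2_mult)
  show ?thesis
  proof (cases "u \<le> v")
    case True
    then have "max 0 (1 - q) = 1 - q" by (simp add: q_def)
    with True show ?thesis
      using assms unfolding e
      by (simp add: integral_band_kernel_mult' band_cov_def add.commute flip: q_def)
  next
    case False
    have "1 + 1 / q = (1 + q) / q" using q by (simp add: field_simps)
    then have pow: "(1 / q) ^ j / (1 + 1 / q) ^ (j + i) = q ^ i / (1 + q) ^ (j + i)"
      using q by (simp add: power_divide power_add)
    have sym: "(j + i) choose j = (j + i) choose i"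
      using binomial_symmetric[of j "j + i"] by simp
    have "band_cov j i (1 / q) =
        - (1 / real (j + i) * real ((j + i) choose j) * ((1 / q) ^ j / (1 + 1 / q) ^ (j + i)))"
      using assms by (simp add: band_cov_def)
    also have "\<dots> = - (1 / real (j + i) * real ((j + i) choose i) * (q ^ i / (1 + q) ^ (j + i)))"
      by (simp only: pow sym)
    finally have "band_cov j i (1 / q) = \<dots>" .
    moreover have "exp (v - u) = 1 / q"
      by (simp add: q_def exp_diff)
    moreover have "max 0 (1 - q) = 0" using False by (simp add: q_def)
    ultimately show ?thesis
      using False assms unfolding e
      by (simp add: integral_band_kernel_mult' power_0_left flip: q_def)
  qed
qed

lemma integral_Z_kernel_eq_cross_cov_Z:
  assumes "1 \<le> l"
  shows "(\<integral>z. Z_kernel l u z * Z_kernel (l + n) v z \<partial>intensity) = cross_cov_Z l n u v"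
proof -
  let ?c = "\<lambda>i j. \<integral>z. band_kernel i u z * band_kernel j v z \<partial>intensity"
  have split: "(\<Sum>j<l+n. a j) = (\<Sum>j<l. a j) + (\<Sum>r<n. a (l + r))" for a :: "nat \<Rightarrow> real"
    by (induction n) auto
  have "(\<integral>z. Z_kernel l u z * Z_kernel (l + n) v z \<partial>intensity) = (\<Sum>i<l. \<Sum>j<l. ?c i j) + (\<Sum>i<l. \<Sum>r<n. ?c i (l + r))"
    by (simp add: integral_Z_kernel_mult split sum.distrib)
  also have "(\<Sum>i<l. \<Sum>j<l. ?c i j) = cov_Z l (u - v)"
    using integral_Z_kernel_eq_cov_Z[OF assms, of u v] by (simp add: integral_Z_kernel_mult)
  also have "(\<Sum>i<l. \<Sum>r<n. ?c i (l + r)) = (\<Sum>r<n. \<Sum>i<l. ?c i (l + r))"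
    by (rule sum.swap)
  finally show ?thesis
    by (simp add: cross_cov_Z_def band_kernel_cross_term)
qed

section \<open>Law and increments of the processes\<close>

locale band_noise = wiener M intensity W I
  for M :: "'w measure" and W :: "(real \<times> (nat \<Rightarrow> real)) set \<Rightarrow> 'w \<Rightarrow> real"
    and I :: "(real \<times> (nat \<Rightarrow> real) \<Rightarrow> real) \<Rightarrow> 'w \<Rightarrow> real"
begin

lemma Zl_eq: "Zl I l u \<omega> = - I (Z1_kernel u) \<omega> - (\<Sum>k\<in>{1..<l}. I (band_kernel k u) \<omega>)"
  by (simp add: Zl_def Z1_def Xk_def Z1_kernel_def band_kernel_def)

lemma Zl_measurable [measurable]: "Zl I l u \<in> borel_measurable M"
  unfolding Zl_eq[abs_def]
  using I_measurable[OF square_integrable_Z1_kernel] I_measurable[OF square_integrable_band_kernel]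
  by measurable

lemma AE_Zl:
  assumes "1 \<le> l"
  shows "AE \<omega> in M. Zl I l u \<omega> = I (Z_kernel l u) \<omega>"
proof -
  have "AE \<omega> in M. I (Z1_kernel u) \<omega> = I (band_kernel 0 u) \<omega>"
    by (intro I_cong_AE square_integrable_Z1_kernel square_integrable_band_kernel AE_Z1_kernel)
  moreover have "AE \<omega> in M. I (Z_kernel l u) \<omega> = (\<Sum>k<l. - 1 * I (band_kernel k u) \<omega>)"
    unfolding Z_kernel_def[abs_def] by (intro I_sum square_integrable_band_kernel) simp
  ultimately show ?thesis
  proof eventually_elim
    case (elim \<omega>)
    have "{..<l} = insert 0 {1..<l}" using assms by auto
    then show ?case using elim by (simp add: Zl_eq sum_negf)
  qed
qed

lemma Zl_product:
  assumes "1 \<le> l" "1 \<le> l'"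
  shows "(\<integral>\<omega>. Zl I l u \<omega> * Zl I l' v \<omega> \<partial>M) = (\<integral>z. Z_kernel l u z * Z_kernel l' v z \<partial>intensity)"
proof -
  note [measurable] = I_measurable[OF square_integrable_Z_kernel]
  have "AE \<omega> in M. Zl I l u \<omega> * Zl I l' v \<omega> = I (Z_kernel l u) \<omega> * I (Z_kernel l' v) \<omega>"
    using AE_Zl[OF assms(1), of u] AE_Zl[OF assms(2), of v] by eventually_elim simp
  then have "(\<integral>\<omega>. Zl I l u \<omega> * Zl I l' v \<omega> \<partial>M) = (\<integral>\<omega>. I (Z_kernel l u) \<omega> * I (Z_kernel l' v) \<omega> \<partial>M)"
    by (intro integral_cong_AE) auto
  then show ?thesis
    by (simp add: I_product square_integrable_Z_kernel)
qed

text \<open>Separating the index i from the time \<open>g i\<close> allows shifted times, as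
  stationarity requires, and repeated times, as increments with u = v require.\<close>

lemma Zl_sum_centered_normal:
  assumes "1 \<le> l" "finite J"
  shows "centered_normal M (\<lambda>\<omega>. \<Sum>i\<in>J. c i * Zl I l (g i) \<omega>)
    (\<Sum>i\<in>J. \<Sum>j\<in>J. c i * c j * cov_Z l (g i - g j))"
proof (rule centered_normal_cong_AE)
  show "centered_normal M (\<lambda>\<omega>. \<Sum>i\<in>J. c i * I (Z_kernel l (g i)) \<omega>)
    (\<Sum>i\<in>J. \<Sum>j\<in>J. c i * c j * cov_Z l (g i - g j))"
    using I_sum_centered_normal[OF assms(2), of "\<lambda>i. Z_kernel l (g i)" c]
    by (simp add: integral_Z_kernel_eq_cov_Z[OF assms(1)] square_integrable_Z_kernel)
  have "AE \<omega> in M. \<forall>i\<in>J. Zl I l (g i) \<omega> = I (Z_kernel l (g i)) \<omega>"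
    using assms by (intro AE_finite_allI AE_Zl)
  then show "AE \<omega> in M. (\<Sum>i\<in>J. c i * I (Z_kernel l (g i)) \<omega>) = (\<Sum>i\<in>J. c i * Zl I l (g i) \<omega>)"
    by eventually_elim simp
qed measurable

text \<open>The two terms are indexed by truth values, since the set of times u and v would collapse
  when u = v.\<close>

lemma Zl_diff_centered_normal:
  assumes "1 \<le> l"
  shows "centered_normal M (\<lambda>\<omega>. Zl I l u \<omega> - Zl I l v \<omega>) (2 * (cov_Z l 0 - cov_Z l (u - v)))"
  using Zl_sum_centered_normal[OF assms, of UNIV "\<lambda>b. if b then 1 else - 1" "\<lambda>b. if b then u else v"]
    cov_Z_even[of l "u - v"]
  by (simp add: UNIV_bool algebra_simps)

lemma Zl_increment_moments:
  assumes "1 \<le> l" "1 \<le> m"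
  shows "\<exists>C. \<forall>u v. \<bar>u - v\<bar> \<le> 1 \<longrightarrow>
    integrable M (\<lambda>\<omega>. (Zl I l u \<omega> - Zl I l v \<omega>) ^ (2 * m)) \<and>
    expectation (\<lambda>\<omega>. (Zl I l u \<omega> - Zl I l v \<omega>) ^ (2 * m)) \<le> C * \<bar>u - v\<bar> ^ m"
proof -
  obtain C where C: "0 \<le> C" "\<And>t. cov_Z l 0 - cov_Z l t \<le> C * \<bar>t\<bar>"
    using cov_Z_lipschitz_at_0 by blast
  let ?a = "fact (2 * m) / (2 ^ m * fact m) :: real"
  have "integrable M (\<lambda>\<omega>. (Zl I l u \<omega> - Zl I l v \<omega>) ^ (2 * m)) \<and>
    expectation (\<lambda>\<omega>. (Zl I l u \<omega> - Zl I l v \<omega>) ^ (2 * m)) \<le> ?a * (2 * C) ^ m * \<bar>u - v\<bar> ^ m" for u v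
  proof -
    note n = Zl_diff_centered_normal[OF assms(1), of u v]
    \<comment> \<open>Being a variance, the quantity is nonnegative; this is what permits raising
      the Lipschitz bound to the power m.\<close>
    have "0 \<le> 2 * (cov_Z l 0 - cov_Z l (u - v))" using n unfolding centered_normal_def by linarith
    then have "(2 * (cov_Z l 0 - cov_Z l (u - v))) ^ m \<le> (2 * C * \<bar>u - v\<bar>) ^ m"
      using C(2)[of "u - v"] by (intro power_mono) auto
    then have "?a * (2 * (cov_Z l 0 - cov_Z l (u - v))) ^ m \<le> ?a * (2 * C * \<bar>u - v\<bar>) ^ m"
      by (intro mult_left_mono) auto
    then show ?thesis
      using centered_normal_even_moment[OF n assms(2)] by (simp add: power_mult_distrib mult.assoc)
  qed
  then show ?thesis by blast
qed

text \<open>The variance of a linear combination involves only differences of times, so a shift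
  leaves the laws of all combinations, and with them the joint law, unchanged.\<close>

lemma Zl_stationary:
  assumes "1 \<le> l"
  shows "stationary_process M (Zl I l)"
  unfolding stationary_process_def
proof (intro allI impI)
  fix J :: "real set" and h :: real
  assume "finite J"
  then show "distr M (PiM J (\<lambda>_. borel)) (\<lambda>\<omega>. \<lambda>i\<in>J. Zl I l (i + h) \<omega>) =
      distr M (PiM J (\<lambda>_. borel)) (\<lambda>\<omega>. \<lambda>i\<in>J. Zl I l i \<omega>)"
    using Zl_sum_centered_normal[OF assms, of J _ "\<lambda>i. i + h"] Zl_sum_centered_normal[OF assms, of J _ "\<lambda>i. i"]
    by (intro joint_law_unique_centered_normal) auto
qed

lemma Zl_gaussian:
  assumes "1 \<le> l"
  shows "centered_gaussian_family M UNIV (Zl I l)"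
  unfolding centered_gaussian_family_def
  using Zl_sum_centered_normal[OF assms, of _ _ "\<lambda>i. i"] by auto

end

theorem theorem1p8:
  fixes M :: "'w measure"
    and W :: "(real \<times> (nat \<Rightarrow> real)) set \<Rightarrow> 'w \<Rightarrow> real"
    and I :: "((real \<times> (nat \<Rightarrow> real)) \<Rightarrow> real) \<Rightarrow> 'w \<Rightarrow> real"
  assumes "prob_space M"
    and "gaussian_white_noise M intensity W"
    and "wiener_integral M intensity W I"
  shows "\<forall>l\<ge>1.
      centered_gaussian_family M UNIV (Zl I l) \<and>
      stationary_process M (Zl I l) \<and>
      (\<forall>u v. integral\<^sup>L M (\<lambda>\<omega>. Zl I l u \<omega> * Zl I l v \<omega>) = cov_Z l (u - v)) \<and>
      (\<forall>n u v. integral\<^sup>L M (\<lambda>\<omega>. Zl I l u \<omega> * Zl I (l + n) v \<omega>) = cross_cov_Z l n u v) \<and>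
      (\<exists>Z'. (\<forall>u. Z' u \<in> borel_measurable M \<and> (AE \<omega> in M. Z' u \<omega> = Zl I l u \<omega>)) \<and>
            (\<forall>\<omega>\<in>space M. \<forall>\<alpha>. 0 < \<alpha> \<and> \<alpha> < 1/2 \<longrightarrow> locally_holder (\<lambda>u. Z' u \<omega>) \<alpha>))"
proof -
  interpret prob_space M by fact
  interpret band_noise M W I by unfold_locales fact+
  show ?thesis
  proof (intro allI impI conjI)
    fix l :: nat assume l: "1 \<le> l"
    show "centered_gaussian_family M UNIV (Zl I l)" "stationary_process M (Zl I l)"
      using l by (rule Zl_gaussian Zl_stationary)+
    show "integral\<^sup>L M (\<lambda>\<omega>. Zl I l u \<omega> * Zl I l v \<omega>) = cov_Z l (u - v)" for u v
      using l by (simp add: Zl_product integral_Z_kernel_eq_cov_Z)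
    show "integral\<^sup>L M (\<lambda>\<omega>. Zl I l u \<omega> * Zl I (l + n) v \<omega>) = cross_cov_Z l n u v" for n u v
      using l by (simp add: Zl_product integral_Z_kernel_eq_cross_cov_Z)
    show "\<exists>Z'. (\<forall>u. Z' u \<in> borel_measurable M \<and> (AE \<omega> in M. Z' u \<omega> = Zl I l u \<omega>)) \<and>
            (\<forall>\<omega>\<in>space M. \<forall>\<alpha>. 0 < \<alpha> \<and> \<alpha> < 1/2 \<longrightarrow> locally_holder (\<lambda>u. Z' u \<omega>) \<alpha>)"
      using l by (intro holder_version Zl_increment_moments) auto
  qed
qed

end
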